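(* Let $I\ge0$, $\beta>0$, $\omega\in S_I$, and suppose $(1,\omega,\beta)$ (initial condition $\alpha=(1,0,\dots,0)$, all urns empty) is a feasible constraint, with associated twist parameters $\rho>0$, $C\ge0$. Then the infimum of $J(\gamma)$ over $A(1,\omega,\beta)$ is achieved by the occupancy path $\gamma\in A(1,\omega,\beta)$ defined by $$\gamma_0(x)=Ce^{-\rho x}+\sum_{k=0}^I\big(\omega_k-C\mathcal{P}_k(\rho\beta)\big)\Big(1-\frac{x}{\beta}\Big)^k,$$ $$\gamma_i(x)=\frac{x^i}{i!}(-1)^i\gamma_0^{(i)}(x),\quad 1\le i\le I,\qquad \gamma_{I+}(x)=1-\sum_{i=0}^I\gamma_i(x).$$ In addition, $\gamma$ satisfies the Euler–Lagrange equations.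
   Context: $S_I=\{\gamma\in\mathbb{R}^{I+2}:\gamma_j\ge0,\sum_{j=0}^{I+1}\gamma_j=1\}$, components indexed $0,\dots,I,I+$. Valid occupancy functions on $[0,\beta]$: absolutely continuous $\gamma:[0,\beta]\to S_I$ whose rates $\theta$ ($\dot\gamma_0=-\theta_0$, $\dot\gamma_j=\theta_{j-1}-\theta_j$, $1\le j\le I$, $\dot\gamma_{I+}=\theta_I$, $\sum\theta_j=1$) lie in $S_I$ a.e.; cumulative occupancies $\psi_i=\sum_{j\le i}\gamma_j$ ($\psi_{-1}\equiv0$), so $\dot\psi_i=-\theta_i$. $J(\gamma)=\int_0^\beta D(\theta\|\gamma)dx$ (relative entropy) for valid $\gamma$, $\infty$ otherwise. $A(\alpha,\omega,\beta)$: valid $\gamma$ with $\gamma(0)=\alpha,\gamma(\beta)=\omega$; feasible means nonempty; for empty initial condition this holds iff $\sum_{i=0}^I i\omega_i+(I+1)\omega_{I+}\le\beta$. $\mathcal{P}_i(t)=e^{-t}t^i/i!$. Twist parameters: if $\sum_{i=0}^I i\omega_i+(I+1)\omega_{I+}=\beta$, then (replacing $I$ by $I+1$ if necessary, regarding $\omega_{I+}$ as the fraction with exactly $I+1$ balls, so that $\omega_{I+}=0$) $C=0$ and $\rho=1$. Otherwise $\rho$ is the unique positive root of $\frac{\rho\beta-\sum_{i=0}^I i\mathcal{P}_i(\rho\beta)}{1-\sum_{i=0}^I\mathcal{P}_i(\rho\beta)}=\frac{\beta-\sum_{i=0}^I i\omega_i}{1-\sum_{i=0}^I\omega_i}$ and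 $C=\frac{1-\sum_{i=0}^I\omega_i}{1-\sum_{i=0}^I\mathcal{P}_i(\rho\beta)}$. Euler–Lagrange equations: with $\theta_{I+}=1-\sum_{i\le I}\theta_i$ and local cost $L(\psi,\theta)=\sum_{i=0}^I\theta_i\log\frac{\theta_i}{\psi_i-\psi_{i-1}}+\theta_{I+}\log\frac{\theta_{I+}}{1-\psi_I}$, they are $\frac{\partial L}{\partial\psi_i}(\psi(x),\theta(x))=-\frac{d}{dx}\frac{\partial L}{\partial\theta_i}(\psi(x),\theta(x))$ for $i=0,\dots,I$, $x\in(0,\beta)$, i.e. $-\frac{\theta_i}{\gamma_i}+\frac{\theta_{i+1}}{\gamma_{i+1}}=\frac{d}{dx}\{-\log\frac{\theta_i}{\gamma_i}+\log\frac{\theta_{I+}}{1-\psi_I}\}$ for $0\le i\le I-1$ and $-\frac{\theta_I}{\gamma_I}+\frac{\theta_{I+}}{1-\psi_I}=\frac{d}{dx}\{-\log\frac{\theta_I}{\gamma_I}+\log\frac{\theta_{I+}}{1-\psi_I}\}$. In the case $C=0$ (where $\psi_I\equiv1$, $\theta_I=\theta_{I+}=0$) they are the reduced equations $-\frac{\theta_i}{\psi_i-\psi_{i-1}}+\frac{\theta_{i+1}}{\psi_{i+1}-\psi_i}=\frac{d}{dx}\{-\log\frac{\theta_i}{\psi_i-\psi_{i-1}}\}$, $0\le i\le I-1$. *)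

theory Defs
  imports "HOL-Analysis.Analysis"
begin

text \<open>Vectors in S_I are represented as functions nat => real; component j for
  0 <= j <= I is gamma_j, and component I+1 stands for gamma_{I+}.  Components with
  index > I+1 are ignored everywhere.\<close>

definition in_SI :: "nat \<Rightarrow> (nat \<Rightarrow> real) \<Rightarrow> bool" where
  "in_SI I v \<longleftrightarrow> (\<forall>j\<le>Suc I. 0 \<le> v j) \<and> (\<Sum>j\<le>Suc I. v j) = 1"

definition poisP :: "nat \<Rightarrow> real \<Rightarrow> real" where
  "poisP i t = exp (- t) * t ^ i / fact i"

definition abs_cont_on :: "real \<Rightarrow> real \<Rightarrow> (real \<Rightarrow> real) \<Rightarrow> bool" where
  "abs_cont_on a b f \<longleftrightarrow>
     (\<forall>\<epsilon>>0. \<exists>\<delta>>0. \<forall>(n::nat) (l::nat \<Rightarrow> real) (u::nat \<Rightarrow> real).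
        (\<forall>k<n. a \<le> l k \<and> l k \<le> u k \<and> u k \<le> b) \<and>
        (\<forall>k<n. \<forall>k'<n. k \<noteq> k' \<longrightarrow> u k \<le> l k' \<or> u k' \<le> l k) \<and>
        (\<Sum>k<n. u k - l k) < \<delta> \<longrightarrow>
        (\<Sum>k<n. \<bar>f (u k) - f (l k)\<bar>) < \<epsilon>)"

definition drift :: "nat \<Rightarrow> (nat \<Rightarrow> real) \<Rightarrow> nat \<Rightarrow> real" where
  "drift I \<theta> j = (if j = 0 then - \<theta> 0 else if j \<le> I then \<theta> (j - 1) - \<theta> j else \<theta> I)"

definition rates :: "nat \<Rightarrow> real \<Rightarrow> (real \<Rightarrow> nat \<Rightarrow> real) \<Rightarrow> (real \<Rightarrow> nat \<Rightarrow> real) \<Rightarrow> bool" where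
  "rates I \<beta> \<gamma> \<theta> \<longleftrightarrow>
     (\<forall>j. (\<lambda>x. \<theta> x j) \<in> borel_measurable borel) \<and>
     (AE x in lborel. x \<in> {0<..<\<beta>} \<longrightarrow>
        in_SI I (\<theta> x) \<and>
        (\<forall>j\<le>Suc I. ((\<lambda>t. \<gamma> t j) has_real_derivative drift I (\<theta> x) j) (at x)))"

definition valid :: "nat \<Rightarrow> real \<Rightarrow> (real \<Rightarrow> nat \<Rightarrow> real) \<Rightarrow> bool" where
  "valid I \<beta> \<gamma> \<longleftrightarrow>
     (\<forall>x\<in>{0..\<beta>}. in_SI I (\<gamma> x)) \<and>
     (\<forall>j\<le>Suc I. abs_cont_on 0 \<beta> (\<lambda>t. \<gamma> t j)) \<and>
     (\<exists>\<theta>. rates I \<beta> \<gamma> \<theta>)"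

definition relent :: "nat \<Rightarrow> (nat \<Rightarrow> real) \<Rightarrow> (nat \<Rightarrow> real) \<Rightarrow> ereal" where
  "relent I \<theta> g =
     (if \<exists>j\<le>Suc I. \<theta> j > 0 \<and> g j = 0 then \<infinity>
      else ereal (\<Sum>j\<le>Suc I. if \<theta> j = 0 then 0 else \<theta> j * ln (\<theta> j / g j)))"

text \<open>The rate functional J (the rates are unique a.e., so the choice does not matter).\<close>
definition Jfun :: "nat \<Rightarrow> real \<Rightarrow> (real \<Rightarrow> nat \<Rightarrow> real) \<Rightarrow> ennreal" where
  "Jfun I \<beta> \<gamma> =
     (if valid I \<beta> \<gamma>
      then (\<integral>\<^sup>+ x \<in> {0..\<beta>}. e2ennreal (relent I ((SOME \<theta>. rates I \<beta> \<gamma> \<theta>) x) (\<gamma> x)) \<partial>lborel)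
      else \<infinity>)"

definition Aset :: "nat \<Rightarrow> (nat \<Rightarrow> real) \<Rightarrow> (nat \<Rightarrow> real) \<Rightarrow> real \<Rightarrow> (real \<Rightarrow> nat \<Rightarrow> real) set" where
  "Aset I \<alpha> \<omega> \<beta> = {\<gamma>. valid I \<beta> \<gamma> \<and> (\<forall>j\<le>Suc I. \<gamma> 0 j = \<alpha> j \<and> \<gamma> \<beta> j = \<omega> j)}"

definition empty_init :: "nat \<Rightarrow> real" where
  "empty_init j = (if j = 0 then 1 else 0)"

definition tight :: "nat \<Rightarrow> (nat \<Rightarrow> real) \<Rightarrow> real \<Rightarrow> bool" where
  "tight I \<omega> \<beta> \<longleftrightarrow> (\<Sum>i\<le>I. real i * \<omega> i) + real (Suc I) * \<omega> (Suc I) = \<beta>"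

definition twist :: "nat \<Rightarrow> (nat \<Rightarrow> real) \<Rightarrow> real \<Rightarrow> real \<Rightarrow> real \<Rightarrow> bool" where
  "twist I \<omega> \<beta> \<rho> C \<longleftrightarrow>
     (if tight I \<omega> \<beta> then C = 0 \<and> \<rho> = 1
      else \<rho> > 0 \<and>
        (\<rho> * \<beta> - (\<Sum>i\<le>I. real i * poisP i (\<rho> * \<beta>))) / (1 - (\<Sum>i\<le>I. poisP i (\<rho> * \<beta>)))
          = (\<beta> - (\<Sum>i\<le>I. real i * \<omega> i)) / (1 - (\<Sum>i\<le>I. \<omega> i)) \<and>
        C = (1 - (\<Sum>i\<le>I. \<omega> i)) / (1 - (\<Sum>i\<le>I. poisP i (\<rho> * \<beta>))))"

text \<open>Effective number of tracked levels: in the tight case with omega_{I+} > 0, I is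
  replaced by I+1 and omega_{I+} is regarded as the fraction with exactly I+1 balls.\<close>
definition effI :: "nat \<Rightarrow> (nat \<Rightarrow> real) \<Rightarrow> real \<Rightarrow> nat" where
  "effI I \<omega> \<beta> = (if tight I \<omega> \<beta> \<and> \<omega> (Suc I) > 0 then Suc I else I)"

definition opt0 :: "nat \<Rightarrow> (nat \<Rightarrow> real) \<Rightarrow> real \<Rightarrow> real \<Rightarrow> real \<Rightarrow> real \<Rightarrow> real" where
  "opt0 I \<omega> \<beta> \<rho> C x =
     C * exp (- \<rho> * x) +
     (\<Sum>k\<le>effI I \<omega> \<beta>. (\<omega> k - C * poisP k (\<rho> * \<beta>)) * (1 - x / \<beta>) ^ k)"

definition optpath :: "nat \<Rightarrow> (nat \<Rightarrow> real) \<Rightarrow> real \<Rightarrow> real \<Rightarrow> real \<Rightarrow> real \<Rightarrow> nat \<Rightarrow> real" where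
  "optpath I \<omega> \<beta> \<rho> C x j =
     (if j \<le> I then x ^ j / fact j * (-1) ^ j * (deriv ^^ j) (opt0 I \<omega> \<beta> \<rho> C) x
      else if j = Suc I then
        1 - (\<Sum>i\<le>I. x ^ i / fact i * (-1) ^ i * (deriv ^^ i) (opt0 I \<omega> \<beta> \<rho> C) x)
      else 0)"

definition pathrates :: "nat \<Rightarrow> (real \<Rightarrow> nat \<Rightarrow> real) \<Rightarrow> real \<Rightarrow> nat \<Rightarrow> real" where
  "pathrates I \<gamma> x j =
     (if j \<le> I then - deriv (\<lambda>y. \<Sum>k\<le>j. \<gamma> y k) x
      else 1 - (\<Sum>i\<le>I. - deriv (\<lambda>y. \<Sum>k\<le>i. \<gamma> y k) x))"

definition EL_full :: "nat \<Rightarrow> real \<Rightarrow> (real \<Rightarrow> nat \<Rightarrow> real) \<Rightarrow> bool" where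
  "EL_full I \<beta> \<gamma> \<longleftrightarrow>
     (let \<theta> = pathrates I \<gamma>; \<psi> = (\<lambda>i x. \<Sum>k\<le>i. \<gamma> x k) in
      \<forall>x\<in>{0<..<\<beta>}.
        (\<forall>i<I. ((\<lambda>y. - ln (\<theta> y i / \<gamma> y i) + ln (\<theta> y (Suc I) / (1 - \<psi> I y)))
                  has_real_derivative
                  (- \<theta> x i / \<gamma> x i + \<theta> x (Suc i) / \<gamma> x (Suc i))) (at x)) \<and>
        ((\<lambda>y. - ln (\<theta> y I / \<gamma> y I) + ln (\<theta> y (Suc I) / (1 - \<psi> I y)))
                  has_real_derivative
                  (- \<theta> x I / \<gamma> x I + \<theta> x (Suc I) / (1 - \<psi> I x))) (at x))"

text \<open>Reduced Euler--Lagrange equations (case C = 0), with K the effective I.\<close>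
definition EL_reduced :: "nat \<Rightarrow> nat \<Rightarrow> real \<Rightarrow> (real \<Rightarrow> nat \<Rightarrow> real) \<Rightarrow> bool" where
  "EL_reduced I K \<beta> \<gamma> \<longleftrightarrow>
     (let \<theta> = pathrates I \<gamma>; \<psi> = (\<lambda>i x. if i = 0 then 0 else \<Sum>k\<le>i - 1. \<gamma> x k) in
      \<forall>x\<in>{0<..<\<beta>}. \<forall>i<K.
        ((\<lambda>y. - ln (\<theta> y i / (\<psi> (Suc i) y - \<psi> i y)))
           has_real_derivative
           (- \<theta> x i / (\<psi> (Suc i) x - \<psi> i x) + \<theta> x (Suc i) / (\<psi> (Suc (Suc i)) x - \<psi> (Suc i) x))) (at x))"

end

theory Submission
  imports Defs
begin

text \<open>Write \<open>G\<^sub>j\<close> for \<open>(-1)\<^sup>j\<close> times the \<open>j\<close>-th derivative of the proposed \<open>\<gamma>\<^sub>0\<close>. The proposed path has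
  \<open>\<gamma>\<^sub>j = x\<^sup>j G\<^sub>j / j!\<close> and \<open>\<theta>\<^sub>j = x\<^sup>j G\<^sub>j\<^sub>+\<^sub>1 / j!\<close>, so its rate-to-occupancy ratios are
  \<open>r\<^sub>j = G\<^sub>j\<^sub>+\<^sub>1 / G\<^sub>j\<close>, and the twist parameters are chosen to make the ratio at the overflow level
  constant. Since \<open>D(\<theta> | \<gamma>)\<close> is convex and homogeneous of degree one, it lies above its tangent at any
  ray: \<open>D(\<theta> | \<gamma>) \<ge> 1 + \<Sum> (\<theta>\<^sub>j ln r\<^sub>j - \<gamma>\<^sub>j r\<^sub>j)\<close>, with equality for the proposed path. Along every
  competitor the right-hand side is, almost everywhere, the derivative of the absolutely continuous
  function \<open>x + \<Sum> \<gamma>\<^sub>j ln G\<^sub>j + ln \<rho> (x - \<Sum> j \<gamma>\<^sub>j)\<close>, whose boundary values depend only on the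
  constraint. Integrating up to \<open>b < \<beta>\<close> and letting \<open>b\<close> tend to \<open>\<beta>\<close> (where \<open>ln G\<^sub>j\<close> may be
  singular) bounds the cost of every competitor from below by that of the proposed path. In the tight
  case some \<open>G\<^sub>j\<close> may vanish identically, and then \<open>\<theta>\<^sub>j\<^sub>-\<^sub>1 = 0\<close> almost everywhere for all competitors.\<close>


section \<open>Calculus of absolutely continuous functions\<close>

text \<open>Interiors of distinct members are disjoint, so a nondegenerate interval carries only one
  tag. Hence \<open>snd\<close> is injective on \<open>p\<close>, and the sum is the measure of the
  union of a genuine division.\<close>

lemma content_tagged_partial_division_le:
  fixes T :: "real set"
  assumes p: "p tagged_partial_division_of S" and sub: "\<And>x K. (x, K) \<in> p \<Longrightarrow> K \<subseteq> T"
    and pos: "\<And>x K. (x, K) \<in> p \<Longrightarrow> interior K \<noteq> {}"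
    and T: "T \<in> lmeasurable"
  shows "(\<Sum>(x, K)\<in>p. measure lborel K) \<le> measure lebesgue T"
proof -
  have inj: "inj_on snd p"
  proof (rule inj_onI, clarify)
    fix x K x' K' assume h: "(x, K) \<in> p" "(x', K') \<in> p" and "snd (x, K) = snd (x', K')"
    then have KK: "K = K'" by simp
    show "x = x' \<and> K = K'"
    proof (rule ccontr)
      assume "\<not> ?thesis"
      then have "interior K \<inter> interior K' = {}"
        using tagged_partial_division_ofD(5)[OF p h] by auto
      then show False using pos[OF h(1)] KK by simp
    qed
  qed
  have div: "snd ` p division_of \<Union> (snd ` p)"
    using division_of_tagged_division tagged_partial_division_of_Union_self[OF p] by blast
  have "(\<Sum>(x, K)\<in>p. measure lborel K) = (\<Sum>K\<in>snd ` p. measure lborel K)"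
    using inj by (simp add: sum.reindex case_prod_unfold)
  also have "\<dots> = measure lebesgue (\<Union> (snd ` p))"
  proof -
    have "measure lborel K = measure lebesgue K" if "K \<in> snd ` p" for K
      using division_ofD(4)[OF div that] by auto
    then show ?thesis using content_division[OF div] by simp
  qed
  also have "\<dots> \<le> measure lebesgue T"
  proof (rule measure_mono_fmeasurable[OF _ _ T])
    show "\<Union> (snd ` p) \<subseteq> T" using sub by force
    show "\<Union> (snd ` p) \<in> sets lebesgue"
      using div lmeasurable_division by (metis fmeasurableD)
  qed
  finally show ?thesis .
qed

text \<open>Bridge from the indexed families in \<open>abs_cont_on\<close> to the tagged divisions
  of the gauge integral. Nondegeneracy turns disjointness of interiors into an ordering of the end
  points, which is the form of disjointness in the definition.\<close>

lemma abs_cont_on_tagged_partial_division: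
  assumes ac: "\<And>(n::nat) (l::nat \<Rightarrow> real) (u::nat \<Rightarrow> real).
        (\<forall>k<n. a \<le> l k \<and> l k \<le> u k \<and> u k \<le> b) \<Longrightarrow>
        (\<forall>k<n. \<forall>k'<n. k \<noteq> k' \<longrightarrow> u k \<le> l k' \<or> u k' \<le> l k) \<Longrightarrow>
        (\<Sum>k<n. u k - l k) < \<delta> \<Longrightarrow> (\<Sum>k<n. \<bar>f (u k) - f (l k)\<bar>) < \<epsilon>"
    and p: "p tagged_partial_division_of {a..b}"
    and pos: "\<And>x K. (x, K) \<in> p \<Longrightarrow> interior K \<noteq> {}"
    and small: "(\<Sum>(x, K)\<in>p. measure lborel K) < \<delta>"
  shows "(\<Sum>(x, K)\<in>p. \<bar>f (Sup K) - f (Inf K)\<bar>) < \<epsilon>"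
proof -
  have fin: "finite p" using tagged_partial_division_ofD(1)[OF p] .
  obtain h where h: "bij_betw h {..<card p} p"
    using ex_bij_betw_nat_finite[OF fin] lessThan_atLeast0 by metis
  have K: "\<exists>l u. K = {l..u} \<and> l < u \<and> a \<le> l \<and> u \<le> b \<and> Inf K = l \<and> Sup K = u" if xK: "(x, K) \<in> p" for x K
  proof -
    obtain l u where K: "K = {l..u}" using tagged_partial_division_ofD(4)[OF p xK] by auto
    have lu: "l < u" using pos[OF that] unfolding K by auto
    have "K \<subseteq> {a..b}" using tagged_partial_division_ofD(3)[OF p that] .
    then show ?thesis using K lu by auto
  qed
  define L where "L k = Inf (snd (h k))" for k
  define U where "U k = Sup (snd (h k))" for k
  have hk: "(fst (h k), snd (h k)) \<in> p" if "k < card p" for k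
    using h that bij_betwE by fastforce
  have "(\<Sum>k<card p. \<bar>f (U k) - f (L k)\<bar>) < \<epsilon>"
  proof (rule ac)
    show "\<forall>k<card p. a \<le> L k \<and> L k \<le> U k \<and> U k \<le> b"
      using K[OF hk] unfolding L_def U_def by force
    show "\<forall>k<card p. \<forall>k'<card p. k \<noteq> k' \<longrightarrow> U k \<le> L k' \<or> U k' \<le> L k"
    proof (intro allI impI)
      fix k k' assume k: "k < card p" "k' < card p" "k \<noteq> k'"
      have "h k \<noteq> h k'" using h k unfolding bij_betw_def inj_on_def by blast
      then have "interior (snd (h k)) \<inter> interior (snd (h k')) = {}"
        using tagged_partial_division_ofD(5)[OF p hk[OF k(1)] hk[OF k(2)]] by auto
      moreover obtain l u where 1: "snd (h k) = {l..u}" "l < u" "L k = l" "U k = u"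
        using K[OF hk[OF k(1)]] unfolding L_def U_def by blast
      moreover obtain l' u' where 2: "snd (h k') = {l'..u'}" "l' < u'" "L k' = l'" "U k' = u'"
        using K[OF hk[OF k(2)]] unfolding L_def U_def by blast
      ultimately have "{max l l'<..<min u u'} = {}" by (auto simp: max_def min_def)
      then have "min u u' \<le> max l l'" by (metis greaterThanLessThan_empty_iff)
      then show "U k \<le> L k' \<or> U k' \<le> L k" using 1 2 by (auto simp: max_def min_def split: if_splits)
    qed
    have "(\<Sum>k<card p. U k - L k) = (\<Sum>z\<in>p. Sup (snd z) - Inf (snd z))"
      unfolding U_def L_def using sum.reindex_bij_betw[OF h, of "\<lambda>z. Sup (snd z) - Inf (snd z)"] by simp
    also have "\<dots> = (\<Sum>(x, K)\<in>p. measure lborel K)"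
    proof (rule sum.cong[OF refl], clarify)
      fix x M assume "(x, M) \<in> p"
      from K[OF this] obtain l u where "M = {l..u}" "l < u" by blast
      then show "Sup (snd (x, M)) - Inf (snd (x, M)) = measure lborel M" by simp
    qed
    finally show "(\<Sum>k<card p. U k - L k) < \<delta>" using small by simp
  qed
  also have "(\<Sum>k<card p. \<bar>f (U k) - f (L k)\<bar>) = (\<Sum>(x, K)\<in>p. \<bar>f (Sup K) - f (Inf K)\<bar>)"
    unfolding U_def L_def case_prod_unfold
    using sum.reindex_bij_betw[OF h, of "\<lambda>z. \<bar>f (Sup (snd z)) - f (Inf (snd z))\<bar>"] by simp
  finally show ?thesis .
qed

text \<open>The gauge is the derivative gauge off the null set and is confined to an open set of small
  measure on it; absolute continuity controls the intervals tagged in the null set.\<close>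

theorem fundamental_theorem_of_calculus_abs_cont:
  fixes f g :: "real \<Rightarrow> real"
  assumes ab: "a \<le> b" and ac: "abs_cont_on a b f" and N: "negligible N"
    and der: "\<And>x. x \<in> {a..b} - N \<Longrightarrow> (f has_real_derivative g x) (at x within {a..b})"
  shows "(g has_integral (f b - f a)) {a..b}"
proof -
  \<comment> \<open>With the integrand set to 0 on \<open>N\<close>, the error at a tag in
    \<open>N\<close> is the bare increment of \<open>f\<close>. The original integrand is restored
    by \<open>has_integral_spike\<close> at the end.\<close>
  define g' where "g' x = (if x \<in> N then 0 else g x)" for x
  have "(g' has_integral (f b - f a)) (cbox a b)"
    unfolding has_integral
  proof (intro allI impI)
    fix e :: real assume e: "e > 0"
    obtain \<delta> where \<delta>: "\<delta> > 0" and ac': "\<And>(n::nat) (l::nat \<Rightarrow> real) (u::nat \<Rightarrow> real).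
        (\<forall>k<n. a \<le> l k \<and> l k \<le> u k \<and> u k \<le> b) \<Longrightarrow>
        (\<forall>k<n. \<forall>k'<n. k \<noteq> k' \<longrightarrow> u k \<le> l k' \<or> u k' \<le> l k) \<Longrightarrow>
        (\<Sum>k<n. u k - l k) < \<delta> \<Longrightarrow> (\<Sum>k<n. \<bar>f (u k) - f (l k)\<bar>) < e / 2"
    proof -
      have "e / 2 > 0" using e by simp
      from ac[unfolded abs_cont_on_def, rule_format, OF this] show ?thesis using that by blast
    qed
    \<comment> \<open>Outer regularity, with \<delta> the modulus of absolute continuity belonging
      to \<open>e / 2\<close>.\<close>
    obtain T where T: "open T" "N \<subseteq> T" "T \<in> lmeasurable" "measure lebesgue T < \<delta>"
    proof -
      have Ns: "N \<in> null_sets lebesgue" using N negligible_iff_null_sets by blast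
      then obtain T where T: "open T" "N \<subseteq> T" "(T - N) \<in> lmeasurable" "emeasure lebesgue (T - N) < ennreal \<delta>"
        using sets_lebesgue_outer_open[of N \<delta>] \<delta> by blast
      have "T = (T - N) \<union> N" using T by auto
      then have TL: "T \<in> lmeasurable" using T(3) N negligible_imp_measurable fmeasurable.Un by metis
      have "measure lebesgue T = measure lebesgue (T - N)"
        using TL Ns by (simp add: measure_Diff_null_set fmeasurableD)
      also have "\<dots> < \<delta>" using T(3,4) \<delta> by (simp add: emeasure_eq_measure2 ennreal_less_iff)
      finally show ?thesis using that T TL by blast
    qed
    \<comment> \<open>Summed over intervals of total length \<open>b - a\<close>, the slope error
      \<open>e1\<close> costs at most \<open>e / 2\<close>; the summand 1 covers
      \<open>a = b\<close>.\<close>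
    define e1 where "e1 = e / (2 * (b - a + 1))"
    have e1: "e1 > 0" using e ab by (simp add: e1_def)
    have "\<forall>x. \<exists>d>0. (x \<in> {a..b} - N \<longrightarrow>
         (\<forall>y\<in>{a..b}. norm (y-x) < d \<longrightarrow> norm (f y - f x - (y-x) *\<^sub>R g x) \<le> e1 * norm (y-x))) \<and>
         (x \<in> N \<longrightarrow> ball x d \<subseteq> T)"
    proof
      fix x
      show "\<exists>d>0. (x \<in> {a..b} - N \<longrightarrow>
         (\<forall>y\<in>{a..b}. norm (y-x) < d \<longrightarrow> norm (f y - f x - (y-x) *\<^sub>R g x) \<le> e1 * norm (y-x))) \<and>
         (x \<in> N \<longrightarrow> ball x d \<subseteq> T)"
      proof (cases "x \<in> N")
        case True
        then obtain d where "d > 0" "ball x d \<subseteq> T" using T(1,2) openE by blast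
        then show ?thesis using True by blast
      next
        case False
        then show ?thesis
        proof (cases "x \<in> {a..b}")
          case True
          then have "x \<in> {a..b} - N" using False by simp
          from der[OF this, unfolded has_real_derivative_iff_has_vector_derivative
            has_vector_derivative_def has_derivative_within_alt]
          show ?thesis using e1 False by blast
        next
          case False
          then show ?thesis using \<open>x \<notin> N\<close> zero_less_one by blast
        qed
      qed
    qed
    then obtain d where d: "\<And>x. d x > 0"
      and d1: "\<And>x y. \<lbrakk>x \<in> {a..b} - N; y \<in> {a..b}; norm (y-x) < d x\<rbrakk> \<Longrightarrow>
          norm (f y - f x - (y-x) *\<^sub>R g x) \<le> e1 * norm (y-x)"
      and d2: "\<And>x. x \<in> N \<Longrightarrow> ball x (d x) \<subseteq> T"
      by metis
    show "\<exists>\<gamma>. gauge \<gamma> \<and> (\<forall>p. p tagged_division_of cbox a b \<and> \<gamma> fine p \<longrightarrow>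
        norm ((\<Sum>(x, k)\<in>p. measure lborel k *\<^sub>R g' x) - (f b - f a)) < e)"
    proof (intro exI conjI allI impI)
      show "gauge (\<lambda>x. ball x (d x))" using d gauge_ball_dependent by blast
      fix p assume "p tagged_division_of cbox a b \<and> (\<lambda>x. ball x (d x)) fine p"
      then have ptag: "p tagged_division_of cbox a b" and finep: "(\<lambda>x. ball x (d x)) fine p" by auto
      have fin: "finite p" using ptag by blast
      define E where "E = (\<lambda>(x, K). measure lborel K * g' x - (f (Sup K) - f (Inf K)))"
      define p1 where "p1 = {z \<in> p. fst z \<in> N \<and> interior (snd z) \<noteq> {}}"
      have p1: "p1 \<subseteq> p" by (auto simp: p1_def)
      have p1tag: "p1 tagged_partial_division_of {a..b}"
        using tagged_partial_division_subset[OF _ p1] ptag tagged_division_of_def by auto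
      have KE: "\<exists>u v. K = {u..v} \<and> u \<le> x \<and> x \<le> v \<and> a \<le> u \<and> v \<le> b \<and> Sup K = v \<and> Inf K = u \<and> measure lborel K = v - u"
        if xK: "(x, K) \<in> p" for x K
      proof -
        obtain u v where K: "K = {u..v}" using tagged_division_ofD(4)[OF ptag xK] by auto
        have x: "x \<in> K" "K \<subseteq> {a..b}" using tagged_division_ofD(2,3)[OF ptag that] by auto
        then show ?thesis using K by auto
      qed
      have ba: "b - a = (\<Sum>(x,K)\<in>p. Sup K - Inf K)" "f b - f a = (\<Sum>(x,K)\<in>p. f(Sup K) - f(Inf K))"
        using additive_tagged_division_1[where f= "\<lambda>x. x"] additive_tagged_division_1[where f= f]
            ab ptag by auto
      have eq: "(\<Sum>(x, k)\<in>p. measure lborel k *\<^sub>R g' x) - (f b - f a) = sum E p"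
        unfolding ba E_def by (simp add: sum_subtractf case_prod_unfold)
      have "sum E p = sum E p1 + sum E (p - p1)"
        using fin p1 by (simp add: sum.subset_diff)
      moreover have "\<bar>sum E p1\<bar> < e / 2"
      proof -
        have "(\<Sum>(x, K)\<in>p1. \<bar>f (Sup K) - f (Inf K)\<bar>) < e / 2"
        proof (rule abs_cont_on_tagged_partial_division[OF ac' p1tag])
          show "interior K \<noteq> {}" if "(x, K) \<in> p1" for x K using that by (auto simp: p1_def)
          have "(\<Sum>(x, K)\<in>p1. measure lborel K) \<le> measure lebesgue T"
          proof (rule content_tagged_partial_division_le[OF p1tag _ _ T(3)])
            fix x K assume xk: "(x, K) \<in> p1"
            then show "interior K \<noteq> {}" by (auto simp: p1_def)
            show "K \<subseteq> T" using xk finep d2[of x] p1_def by fastforce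
          qed
          then show "(\<Sum>(x, K)\<in>p1. measure lborel K) < \<delta>" using T(4) by simp
        qed auto
        moreover have "\<bar>sum E p1\<bar> \<le> (\<Sum>(x, K)\<in>p1. \<bar>f (Sup K) - f (Inf K)\<bar>)"
          by (rule order_trans[OF sum_abs], rule sum_mono) (auto simp: E_def p1_def g'_def)
        ultimately show ?thesis by linarith
      qed
      moreover have "\<bar>sum E (p - p1)\<bar> \<le> e / 2"
      proof -
        have "\<bar>sum E (p - p1)\<bar> \<le> (\<Sum>z\<in>p-p1. \<bar>E z\<bar>)" by (rule sum_abs)
        also have "\<dots> \<le> (\<Sum>(x,K)\<in>p-p1. e1 * (Sup K - Inf K))"
        proof (rule sum_mono, clarify)
          fix x K assume xk: "(x, K) \<in> p" "(x, K) \<notin> p1"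
          obtain u v where K: "K = {u..v}" "u \<le> x" "x \<le> v" "a \<le> u" "v \<le> b" "Sup K = v" "Inf K = u" "measure lborel K = v - u"
            using KE[OF xk(1)] by blast
          show "\<bar>E (x, K)\<bar> \<le> e1 * (Sup K - Inf K)"
          proof (cases "x \<in> N")
            case True
            \<comment> \<open>Pairs tagged in \<open>N\<close> but outside \<open>p1\<close> have
              degenerate intervals, so their error is zero.\<close>
            then have "interior K = {}" using xk by (auto simp: p1_def)
            then have "u = v" using K by auto
            then show ?thesis using K by (simp add: E_def)
          next
            case False
            have ball: "K \<subseteq> ball x (d x)" using finep xk(1) by blast
            have uv: "norm (u - x) < d x" "norm (v - x) < d x"
              using subsetD[OF ball, of u] subsetD[OF ball, of v] K by (auto simp: dist_real_def)
            have 1: "norm (f u - f x - (u-x) *\<^sub>R g x) \<le> e1 * norm (u-x)"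
              using K False uv by (intro d1) auto
            have 2: "norm (f v - f x - (v-x) *\<^sub>R g x) \<le> e1 * norm (v-x)"
              using K False uv by (intro d1) auto
            \<comment> \<open>Straddle estimate: the interval is split at its tag, and since
              \<open>u \<le> x \<le> v\<close> the two one-sided errors add up to a multiple of
              \<open>v - u\<close>.\<close>
            have "E (x, K) = (f u - f x - (u-x) *\<^sub>R g x) - (f v - f x - (v-x) *\<^sub>R g x)"
              using K False by (simp add: E_def g'_def algebra_simps)
            then have "\<bar>E (x, K)\<bar> \<le> e1 * norm (u-x) + e1 * norm (v-x)"
              using 1 2 by simp
            also have "\<dots> = e1 * (v - u)" using K by (simp add: algebra_simps)
            finally show ?thesis using K by simp
          qed
        qed
        also have "\<dots> \<le> (\<Sum>(x,K)\<in>p. e1 * (Sup K - Inf K))"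
          by (rule sum_mono2[OF fin]) (use KE e1 in force)+
        also have "\<dots> = e1 * (b - a)" unfolding ba(1) by (simp add: sum_distrib_left case_prod_unfold)
        also have "\<dots> \<le> e / 2" unfolding e1_def using ab e by (simp add: field_simps)
        finally show ?thesis .
      qed
      ultimately show "norm ((\<Sum>(x, k)\<in>p. measure lborel k *\<^sub>R g' x) - (f b - f a)) < e"
        unfolding eq by simp
    qed
  qed
  then show ?thesis
    using N by (intro has_integral_spike[of N "{a..b}" g g']) (auto simp: g'_def)
qed

section \<open>Lipschitz functions and almost-everywhere derivatives\<close>

lemma abs_cont_on_lipschitz:
  assumes "L-lipschitz_on {a..b} (f :: real \<Rightarrow> real)"
  shows "abs_cont_on a b f"
  unfolding abs_cont_on_def
proof (intro allI impI)
  fix e :: real assume e: "e > 0"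
  have L: "0 \<le> L" using assms lipschitz_on_nonneg by blast
  show "\<exists>\<delta>>0. \<forall>(n::nat) (l::nat \<Rightarrow> real) (u::nat \<Rightarrow> real).
        (\<forall>k<n. a \<le> l k \<and> l k \<le> u k \<and> u k \<le> b) \<and>
        (\<forall>k<n. \<forall>k'<n. k \<noteq> k' \<longrightarrow> u k \<le> l k' \<or> u k' \<le> l k) \<and>
        (\<Sum>k<n. u k - l k) < \<delta> \<longrightarrow> (\<Sum>k<n. \<bar>f (u k) - f (l k)\<bar>) < e"
  proof (intro exI conjI allI impI; (elim conjE)?)
    show "e / (L + 1) > 0" using e L by simp
    fix n :: nat and l u :: "nat \<Rightarrow> real"
    assume h: "\<forall>k<n. a \<le> l k \<and> l k \<le> u k \<and> u k \<le> b" and s: "(\<Sum>k<n. u k - l k) < e / (L + 1)"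
    have "(\<Sum>k<n. \<bar>f (u k) - f (l k)\<bar>) \<le> (\<Sum>k<n. L * (u k - l k))"
    proof (rule sum_mono)
      fix k assume "k \<in> {..<n}"
      then have "a \<le> l k" "l k \<le> u k" "u k \<le> b" using h by auto
      then show "\<bar>f (u k) - f (l k)\<bar> \<le> L * (u k - l k)"
        using lipschitz_onD[OF assms, of "u k" "l k"] by (simp add: dist_real_def)
    qed
    also have "\<dots> = L * (\<Sum>k<n. u k - l k)" by (simp add: sum_distrib_left)
    also have "\<dots> \<le> L * (e / (L + 1))" using s L by (intro mult_left_mono) auto
    also have "\<dots> < e" using e L by (simp add: field_simps)
    finally show "(\<Sum>k<n. \<bar>f (u k) - f (l k)\<bar>) < e" .
  qed
qed

lemma abs_cont_on_subinterval:
  assumes "abs_cont_on a b f" "a \<le> a'" "b' \<le> b"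
  shows "abs_cont_on a' b' f"
  unfolding abs_cont_on_def
proof (intro allI impI)
  fix e :: real assume "e > 0"
  from assms(1)[unfolded abs_cont_on_def, rule_format, OF this]
  obtain \<delta> where \<delta>: "\<delta> > 0" "\<And>(n::nat) (l::nat \<Rightarrow> real) (u::nat \<Rightarrow> real).
        (\<forall>k<n. a \<le> l k \<and> l k \<le> u k \<and> u k \<le> b) \<and>
        (\<forall>k<n. \<forall>k'<n. k \<noteq> k' \<longrightarrow> u k \<le> l k' \<or> u k' \<le> l k) \<and>
        (\<Sum>k<n. u k - l k) < \<delta> \<Longrightarrow> (\<Sum>k<n. \<bar>f (u k) - f (l k)\<bar>) < e" by blast
  show "\<exists>\<delta>>0. \<forall>(n::nat) (l::nat \<Rightarrow> real) (u::nat \<Rightarrow> real).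
        (\<forall>k<n. a' \<le> l k \<and> l k \<le> u k \<and> u k \<le> b') \<and>
        (\<forall>k<n. \<forall>k'<n. k \<noteq> k' \<longrightarrow> u k \<le> l k' \<or> u k' \<le> l k) \<and>
        (\<Sum>k<n. u k - l k) < \<delta> \<longrightarrow> (\<Sum>k<n. \<bar>f (u k) - f (l k)\<bar>) < e"
  proof (intro exI conjI allI impI)
    show "\<delta> > 0" using \<delta>(1) .
    fix n :: nat and l u :: "nat \<Rightarrow> real"
    assume "(\<forall>k<n. a' \<le> l k \<and> l k \<le> u k \<and> u k \<le> b') \<and>
        (\<forall>k<n. \<forall>k'<n. k \<noteq> k' \<longrightarrow> u k \<le> l k' \<or> u k' \<le> l k) \<and>
        (\<Sum>k<n. u k - l k) < \<delta>"
    then show "(\<Sum>k<n. \<bar>f (u k) - f (l k)\<bar>) < e"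
      using assms(2,3) by (intro \<delta>(2)) force
  qed
qed

lemma AE_lborel_negligible:
  assumes "AE x in lborel. P x"
  shows "negligible {x::real. \<not> P x}"
proof -
  from assms obtain M where M: "{x. \<not> P x} \<subseteq> M" "M \<in> null_sets lborel"
    by (auto elim!: AE_E simp: null_sets_def)
  then have "negligible M" by (simp add: negligible_iff_null_sets null_sets_completionI)
  then show ?thesis using M negligible_subset by blast
qed

lemma abs_cont_on_has_integral_derivative:
  fixes f g :: "real \<Rightarrow> real"
  assumes ab: "a \<le> b" and ac: "abs_cont_on a b f"
    and der: "AE x in lborel. x \<in> {a<..<b} \<longrightarrow> (f has_real_derivative g x) (at x)"
  shows "(g has_integral (f b - f a)) {a..b}"
proof (rule fundamental_theorem_of_calculus_abs_cont[OF ab ac])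
  let ?N = "{x. \<not> (x \<in> {a<..<b} \<longrightarrow> (f has_real_derivative g x) (at x))}"
  show "negligible (?N \<union> {a, b})"
    using AE_lborel_negligible[OF der] by (intro negligible_Un) auto
  show "(f has_real_derivative g x) (at x within {a..b})" if "x \<in> {a..b} - (?N \<union> {a, b})" for x
    using that by (auto intro: has_field_derivative_at_within)
qed

lemma abs_cont_on_nondecreasing:
  fixes f g :: "real \<Rightarrow> real"
  assumes ab: "a \<le> b" and ac: "abs_cont_on a b f"
    and der: "AE x in lborel. x \<in> {a<..<b} \<longrightarrow> (f has_real_derivative g x) (at x) \<and> 0 \<le> g x"
  shows "f a \<le> f b"
proof -
  \<comment> \<open>The truncation agrees with \<open>g\<close> almost everywhere on the interval
    and is nonnegative at every point, as \<open>has_integral_nonneg\<close> requires.\<close>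
  have "AE x in lborel. x \<in> {a<..<b} \<longrightarrow> (f has_real_derivative max 0 (g x)) (at x)"
    using der by eventually_elim (auto simp: max_def)
  from abs_cont_on_has_integral_derivative[OF ab ac this]
  have "((\<lambda>x. max 0 (g x)) has_integral (f b - f a)) {a..b}" .
  then have "0 \<le> f b - f a" by (rule has_integral_nonneg) simp
  then show ?thesis by simp
qed

lemma abs_cont_on_mono_on:
  fixes f g :: "real \<Rightarrow> real"
  assumes ac: "abs_cont_on a b f"
    and der: "AE x in lborel. x \<in> {a<..<b} \<longrightarrow> (f has_real_derivative g x) (at x) \<and> 0 \<le> g x"
    and xy: "a \<le> x" "x \<le> y" "y \<le> b"
  shows "f x \<le> f y"
proof (rule abs_cont_on_nondecreasing[OF xy(2) abs_cont_on_subinterval[OF ac xy(1,3)]])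
  show "AE z in lborel. z \<in> {x<..<y} \<longrightarrow> (f has_real_derivative g z) (at z) \<and> 0 \<le> g z"
    using der by eventually_elim (use xy in auto)
qed

text \<open>A monotone function with equal end values is constant. This is the tool for showing that
  a boundary constraint forces some rates of every competitor to vanish.\<close>

lemma abs_cont_on_derivative_eq_0:
  fixes f g :: "real \<Rightarrow> real"
  assumes ac: "abs_cont_on a b f"
    and der: "AE x in lborel. x \<in> {a<..<b} \<longrightarrow> (f has_real_derivative g x) (at x) \<and> 0 \<le> g x"
    and eq: "f a = f b"
  shows "AE x in lborel. x \<in> {a<..<b} \<longrightarrow> g x = 0"
  using der
proof eventually_elim
  case (elim x)
  show ?case
  proof
    assume x: "x \<in> {a<..<b}"
    have const: "f y = f a" if "y \<in> {a<..<b}" for y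
      using abs_cont_on_mono_on[OF ac der, of a y] abs_cont_on_mono_on[OF ac der, of y b] that eq by auto
    have "(f has_real_derivative 0) (at x)"
      by (rule has_field_derivative_transform_within_open[of "\<lambda>_. f a" _ _ "{a<..<b}"])
        (use x const in auto)
    then show "g x = 0" using elim x DERIV_unique by blast
  qed
qed

text \<open>Applied to occupancies, whose drift is bounded by 1. The Lipschitz property gained in
  this way passes to products and sums, and so to the potential integrated later.\<close>

lemma abs_cont_on_lipschitz_on:
  fixes f g :: "real \<Rightarrow> real"
  assumes ac: "abs_cont_on a b f" and L: "0 \<le> L"
    and der: "AE x in lborel. x \<in> {a<..<b} \<longrightarrow> (f has_real_derivative g x) (at x) \<and> \<bar>g x\<bar> \<le> L"
  shows "L-lipschitz_on {a..b} f"
proof (rule lipschitz_on_leI[OF _ L])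
  fix x y assume xy: "x \<in> {a..b}" "y \<in> {a..b}" "x \<le> y"
  \<comment> \<open>Clamping to \<open>[-L, L]\<close> keeps the derivative almost everywhere and
    makes the bound hold at every point.\<close>
  have "AE z in lborel. z \<in> {x<..<y} \<longrightarrow> (f has_real_derivative max (-L) (min L (g z))) (at z)"
    using der by eventually_elim (use xy in \<open>auto simp: max_def min_def\<close>)
  moreover have "abs_cont_on x y f" using abs_cont_on_subinterval[OF ac] xy by auto
  ultimately have "((\<lambda>z. max (-L) (min L (g z))) has_integral (f y - f x)) {x..y}"
    using abs_cont_on_has_integral_derivative[OF xy(3)] by simp
  then have "norm (f y - f x) \<le> L * measure lborel {x..y}"
    by (rule has_integral_bound_real[where S = "{}", OF L finite.emptyI]) (use L in \<open>auto simp: max_def min_def\<close>)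
  then show "dist (f x) (f y) \<le> L * dist x y"
    using xy by (simp add: dist_real_def abs_minus_commute)
qed

lemma lipschitz_on_mult_real:
  fixes f g :: "real \<Rightarrow> real"
  assumes f: "L-lipschitz_on {a..b} f" and g: "M-lipschitz_on {a..b} g"
  shows "\<exists>K. K-lipschitz_on {a..b} (\<lambda>x. f x * g x)"
proof -
  have bdd: "\<exists>B. \<forall>x\<in>{a..b}. \<bar>h x\<bar> \<le> B" if "N-lipschitz_on {a..b} h" for N and h :: "real \<Rightarrow> real"
    using compact_imp_bounded[OF compact_continuous_image[OF lipschitz_on_continuous_on[OF that] compact_Icc]]
    by (auto simp: bounded_iff)
  obtain A where A: "\<forall>x\<in>{a..b}. \<bar>f x\<bar> \<le> A" using bdd[OF f] by blast
  obtain B where B: "\<forall>x\<in>{a..b}. \<bar>g x\<bar> \<le> B" using bdd[OF g] by blast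
  have L: "0 \<le> L" "0 \<le> M" using f g lipschitz_on_nonneg by blast+
  have "(\<bar>A\<bar> * M + \<bar>B\<bar> * L)-lipschitz_on {a..b} (\<lambda>x. f x * g x)"
  proof (rule lipschitz_onI)
    fix x y assume xy: "x \<in> {a..b}" "y \<in> {a..b}"
    have "\<bar>f x * g x - f y * g y\<bar> = \<bar>f x * (g x - g y) + (f x - f y) * g y\<bar>" by (simp add: algebra_simps)
    also have "\<dots> \<le> \<bar>f x\<bar> * \<bar>g x - g y\<bar> + \<bar>f x - f y\<bar> * \<bar>g y\<bar>"
      by (metis abs_mult abs_triangle_ineq)
    also have "\<dots> \<le> \<bar>A\<bar> * (M * \<bar>x - y\<bar>) + (L * \<bar>x - y\<bar>) * \<bar>B\<bar>"
      using A B L xy lipschitz_onD[OF f xy] lipschitz_onD[OF g xy]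
      by (intro add_mono mult_mono) (force simp: dist_real_def)+
    finally show "dist (f x * g x) (f y * g y) \<le> (\<bar>A\<bar> * M + \<bar>B\<bar> * L) * dist x y"
      by (simp add: dist_real_def algebra_simps)
  qed (use L in simp)
  then show ?thesis by blast
qed

lemma lipschitz_on_sum_real:
  fixes f :: "'i \<Rightarrow> real \<Rightarrow> real"
  assumes "finite A" "\<And>i. i \<in> A \<Longrightarrow> \<exists>L. L-lipschitz_on S (f i)"
  shows "\<exists>L. L-lipschitz_on S (\<lambda>x. \<Sum>i\<in>A. f i x)"
  using assms
proof (induction A rule: finite_induct)
  case empty
  then show ?case using lipschitz_on_constant by auto
next
  case (insert i A)
  then obtain L M where "L-lipschitz_on S (f i)" "M-lipschitz_on S (\<lambda>x. \<Sum>i\<in>A. f i x)" by blast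
  from lipschitz_on_add[OF this] show ?case using insert by auto
qed

lemma lipschitz_on_C1:
  fixes f f' :: "real \<Rightarrow> real"
  assumes der: "\<And>x. x \<in> {a..b} \<Longrightarrow> (f has_real_derivative f' x) (at x)"
    and cont: "continuous_on {a..b} f'"
  shows "\<exists>L. L-lipschitz_on {a..b} f"
proof -
  obtain B where B: "\<forall>x\<in>{a..b}. \<bar>f' x\<bar> \<le> B"
    using compact_imp_bounded[OF compact_continuous_image[OF cont compact_Icc]]
    by (auto simp: bounded_iff)
  have "\<bar>B\<bar>-lipschitz_on {a..b} f"
  proof (rule lipschitz_onI)
    fix x y assume xy: "x \<in> {a..b}" "y \<in> {a..b}"
    have "norm (f x - f y) \<le> \<bar>B\<bar> * norm (x - y)"
      by (rule field_differentiable_bound[of "{a..b}" f f'])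
        (use xy B der in \<open>force intro: has_field_derivative_at_within\<close>)+
    then show "dist (f x) (f y) \<le> \<bar>B\<bar> * dist x y" by (simp add: dist_norm)
  qed simp
  then show ?thesis by blast
qed

section \<open>Increments compared with nonnegative Lebesgue integrals\<close>

lemma lipschitz_on_derivative_bound:
  fixes f :: "real \<Rightarrow> real"
  assumes L: "L-lipschitz_on {a..b} f" and x: "x \<in> {a<..<b}" and der: "(f has_real_derivative D) (at x)"
  shows "\<bar>D\<bar> \<le> L"
proof -
  have "((\<lambda>y. \<bar>(f y - f x) / (y - x)\<bar>) \<longlongrightarrow> \<bar>D\<bar>) (at x)"
    using der by (intro tendsto_rabs) (simp add: has_field_derivative_iff)
  moreover have "\<forall>\<^sub>F y in at x. \<bar>(f y - f x) / (y - x)\<bar> \<le> L"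
  proof -
    have "\<forall>\<^sub>F y in at x. y \<in> {a<..<b} \<and> y \<noteq> x"
      using x by (intro eventually_conj eventually_at_in_open') (auto simp: eventually_at_filter)
    then show ?thesis
    proof eventually_elim
      case (elim y)
      then have "\<bar>f y - f x\<bar> \<le> L * \<bar>y - x\<bar>"
        using lipschitz_onD[OF L, of y x] x by (simp add: dist_real_def)
      then show ?case using elim by (simp add: abs_divide pos_divide_le_eq)
    qed
  qed
  ultimately show ?thesis by (intro tendsto_upperbound) auto
qed

text \<open>The derivative may be negative, whereas \<open>h\<close> is
  \<open>ennreal\<close>-valued, so the comparison goes through the positive part. The Lipschitz
  bound makes the derivative bounded, hence absolutely integrable, and so its positive part is
  integrable.\<close>

lemma lipschitz_increment_le_nn_integral:
  fixes f g :: "real \<Rightarrow> real" and h :: "real \<Rightarrow> ennreal"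
  assumes ab: "a \<le> b" and L: "L-lipschitz_on {a..b} f"
    and der: "AE x in lborel. x \<in> {a<..<b} \<longrightarrow> (f has_real_derivative g x) (at x)"
    and le: "AE x in lborel. x \<in> {a<..<b} \<longrightarrow> ennreal (g x) \<le> h x"
  shows "ennreal (f b - f a) \<le> (\<integral>\<^sup>+ x \<in> {a..b}. h x \<partial>lborel)"
proof -
  \<comment> \<open>\<open>k\<close> is \<open>g\<close> wherever that is the derivative and 0
    elsewhere, so that the bound by \<open>L\<close> holds at every point.\<close>
  define k where "k x = (if x \<in> {a<..<b} \<and> (f has_real_derivative g x) (at x) then g x else 0)" for x
  have L0: "0 \<le> L" using L lipschitz_on_nonneg by blast
  have bound: "\<bar>k x\<bar> \<le> L" for x
    unfolding k_def using lipschitz_on_derivative_bound[OF L] L0 by auto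
  have "AE x in lborel. x \<in> {a<..<b} \<longrightarrow> (f has_real_derivative k x) (at x)"
    using der by eventually_elim (auto simp: k_def)
  from abs_cont_on_has_integral_derivative[OF ab abs_cont_on_lipschitz[OF L] this]
  have int: "(k has_integral (f b - f a)) {a..b}" .
  have "k absolutely_integrable_on {a..b}"
    by (rule absolutely_integrable_integrable_bound[where g = "\<lambda>_. L"])
      (use bound int in \<open>auto intro: integrable_const_ivl\<close>)
  then have "(\<lambda>x. max (k x) 0) absolutely_integrable_on {a..b}"
    by (rule absolutely_integrable_max_1) simp
  then have "(\<lambda>x. max (k x) 0) integrable_on {a..b}"
    by (simp add: absolutely_integrable_on_def)
  then obtain J where J: "((\<lambda>x. max (k x) 0) has_integral J) {a..b}" by blast
  have "f b - f a \<le> J" by (rule has_integral_le[OF int J]) simp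
  then have "ennreal (f b - f a) \<le> ennreal J" by (rule ennreal_leI)
  also have "\<dots> = (\<integral>\<^sup>+ x \<in> {a..b}. ennreal (max (k x) 0) \<partial>lborel)"
    by (rule nn_integral_has_integral_lebesgue'[OF _ J, symmetric]) simp
  also have "\<dots> \<le> (\<integral>\<^sup>+ x \<in> {a..b}. h x \<partial>lborel)"
  proof (rule nn_integral_mono_AE)
    show "AE x in lborel. ennreal (max (k x) 0) * indicator {a..b} x \<le> h x * indicator {a..b} x"
      using le by eventually_elim (auto simp: k_def max_def indicator_def ennreal_neg)
  qed
  finally show ?thesis .
qed

lemma nn_integral_derivative_eq_increment:
  fixes f g :: "real \<Rightarrow> real" and h :: "real \<Rightarrow> ennreal"
  assumes ab: "a \<le> b" and ac: "abs_cont_on a b f"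
    and der: "AE x in lborel. x \<in> {a<..<b} \<longrightarrow> (f has_real_derivative g x) (at x)"
    and eq: "AE x in lborel. x \<in> {a<..<b} \<longrightarrow> h x = ennreal (g x) \<and> 0 \<le> g x"
  shows "(\<integral>\<^sup>+ x \<in> {a..b}. h x \<partial>lborel) = ennreal (f b - f a)"
proof -
  have "AE x in lborel. x \<in> {a<..<b} \<longrightarrow> (f has_real_derivative max (g x) 0) (at x)"
    using der eq by eventually_elim (auto simp: max_def)
  from abs_cont_on_has_integral_derivative[OF ab ac this]
  have int: "((\<lambda>x. max (g x) 0) has_integral (f b - f a)) {a..b}" .
  have "(\<integral>\<^sup>+ x \<in> {a..b}. h x \<partial>lborel) = (\<integral>\<^sup>+ x \<in> {a..b}. ennreal (max (g x) 0) \<partial>lborel)"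
  proof (rule nn_integral_cong_AE)
    have "AE x in lborel. x \<noteq> a \<and> x \<noteq> b"
      using AE_lborel_singleton[of a] AE_lborel_singleton[of b] by eventually_elim auto
    then show "AE x in lborel. h x * indicator {a..b} x = ennreal (max (g x) 0) * indicator {a..b} x"
      using eq by eventually_elim (auto simp: max_def indicator_def)
  qed
  also have "\<dots> = ennreal (f b - f a)"
    by (rule nn_integral_has_integral_lebesgue'[OF _ int]) simp
  finally show ?thesis .
qed

section \<open>Occupancy paths and relative entropy\<close>

lemma sum_drift_mult_atMost:
  assumes "n \<le> I"
  shows "(\<Sum>j\<le>n. drift I t j * l j) = (\<Sum>i<n. t i * (l (Suc i) - l i)) - t n * l n"
  using assms
proof (induction n)
  case 0
  then show ?case by (simp add: drift_def)
next
  case (Suc n)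
  then show ?case by (simp add: drift_def algebra_simps)
qed

text \<open>Summation by parts: mass leaving level \<open>i\<close> enters level
  \<open>i + 1\<close>, and a throw into an overflow urn moves nothing. With \<open>l = real\<close>
  it gives the growth of the mean; with \<open>l j = ln (G j x)\<close> it produces logarithms of
  the ratios.\<close>

lemma sum_drift_mult:
  "(\<Sum>j\<le>Suc I. drift I t j * l j) = (\<Sum>i\<le>I. t i * (l (Suc i) - l i))"
  using sum_drift_mult_atMost[of I I t l]
  by (simp add: drift_def algebra_simps flip: lessThan_Suc_atMost)

lemma sum_drift:
  assumes "i \<le> I"
  shows "(\<Sum>j\<le>i. drift I t j) = - t i"
  using sum_drift_mult_atMost[OF assms, of t "\<lambda>_. 1"] by simp

lemma in_SI_le_1:
  assumes "in_SI I t" "j \<le> Suc I"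
  shows "t j \<le> 1"
  using assms member_le_sum[of j "{..Suc I}" t] by (auto simp: in_SI_def)

lemma abs_drift_le_1:
  assumes "in_SI I t" "j \<le> Suc I"
  shows "\<bar>drift I t j\<bar> \<le> 1"
proof -
  have "0 \<le> t k \<and> t k \<le> 1" if "k \<le> Suc I" for k
    using assms(1) in_SI_le_1 that by (auto simp: in_SI_def)
  from this[of j] this[of "j - 1"] this[of 0] this[of I] assms(2) show ?thesis
    by (cases j) (auto simp: drift_def)
qed

text \<open>The perspective function \<open>a ln (a / b)\<close> lies above its tangent at any ray \<open>a = r b\<close>; the right-hand
  side is linear in both arguments. The junk value \<open>ln 0 = 0\<close> is harmless because of \<open>z\<close>.\<close>

lemma relent_ge_tangent:
  assumes t: "in_SI I t" and g: "in_SI I g"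
    and r: "\<And>j. j \<le> Suc I \<Longrightarrow> 0 \<le> r j" and z: "\<And>j. j \<le> Suc I \<Longrightarrow> r j = 0 \<Longrightarrow> t j = 0"
  shows "ereal (1 + (\<Sum>j\<le>Suc I. t j * ln (r j) - g j * r j)) \<le> relent I t g"
proof (cases "\<exists>j\<le>Suc I. t j > 0 \<and> g j = 0")
  case True
  then show ?thesis by (simp add: relent_def)
next
  case False
  have "t j * ln (r j) - g j * r j + t j \<le> (if t j = 0 then 0 else t j * ln (t j / g j))"
    if j: "j \<le> Suc I" for j
  proof (cases "t j = 0")
    case True
    then show ?thesis using g r[OF j] j by (auto simp: in_SI_def)
  next
    case tj: False
    then have tp: "t j > 0" using t j by (auto simp: in_SI_def less_le)
    then have gp: "g j > 0" using g j False by (auto simp: in_SI_def less_le)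
    have rp: "r j > 0" using r[OF j] z[OF j] tj by linarith
    have "ln (g j * r j / t j) \<le> g j * r j / t j - 1"
      using tp gp rp by (intro ln_le_minus_one) simp
    then have "t j * ln (g j * r j / t j) \<le> t j * (g j * r j / t j - 1)"
      using tp by (intro mult_left_mono) auto
    also have "\<dots> = g j * r j - t j" using tp by (simp add: field_simps)
    finally show ?thesis using tp gp rp by (simp add: ln_mult ln_div algebra_simps)
  qed
  then have "(\<Sum>j\<le>Suc I. t j * ln (r j) - g j * r j + t j)
      \<le> (\<Sum>j\<le>Suc I. if t j = 0 then 0 else t j * ln (t j / g j))"
    by (intro sum_mono) auto
  moreover have "(\<Sum>j\<le>Suc I. t j * ln (r j) - g j * r j + t j) = 1 + (\<Sum>j\<le>Suc I. t j * ln (r j) - g j * r j)"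
    using t by (simp only: sum.distrib in_SI_def)
  ultimately show ?thesis using False by (simp add: relent_def)
qed

lemma relent_eq_tangent:
  assumes t: "in_SI I t" and g: "in_SI I g"
    and r: "\<And>j. j \<le> Suc I \<Longrightarrow> t j = r j * g j"
  shows "relent I t g = ereal (1 + (\<Sum>j\<le>Suc I. t j * ln (r j) - g j * r j))"
proof -
  have fin: "\<not> (\<exists>j\<le>Suc I. t j > 0 \<and> g j = 0)" using r by auto
  have "(if t j = 0 then 0 else t j * ln (t j / g j)) = t j * ln (r j) - g j * r j + t j"
    if "j \<le> Suc I" for j
    using r[OF that] by (auto simp: algebra_simps)
  then have "(\<Sum>j\<le>Suc I. if t j = 0 then 0 else t j * ln (t j / g j))
      = (\<Sum>j\<le>Suc I. t j * ln (r j) - g j * r j + t j)"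
    by (intro sum.cong) auto
  also have "\<dots> = 1 + (\<Sum>j\<le>Suc I. t j * ln (r j) - g j * r j)"
    using t by (simp only: sum.distrib in_SI_def)
  finally show ?thesis using fin by (simp add: relent_def)
qed

text \<open>The tangent at the ray \<open>r = 1\<close> is zero on pairs of probability
  vectors.\<close>

lemma relent_nonneg:
  assumes "in_SI I t" "in_SI I g"
  shows "0 \<le> relent I t g"
proof -
  have "1 + (\<Sum>j\<le>Suc I. t j * ln 1 - g j * 1) = 0"
    using assms(2) by (simp only: in_SI_def sum_subtractf) simp
  then show ?thesis using relent_ge_tangent[OF assms, of "\<lambda>_. 1"] by (simp add: zero_ereal_def)
qed

section \<open>Almost-everywhere uniqueness of the rates\<close>

lemma AsetD:
  assumes "\<gamma> \<in> Aset I \<alpha> \<omega> \<beta>"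
  shows "valid I \<beta> \<gamma>" "\<And>x. x \<in> {0..\<beta>} \<Longrightarrow> in_SI I (\<gamma> x)"
    and "\<And>j. j \<le> Suc I \<Longrightarrow> \<gamma> 0 j = \<alpha> j" "\<And>j. j \<le> Suc I \<Longrightarrow> \<gamma> \<beta> j = \<omega> j"
  using assms by (auto simp: Aset_def valid_def)

lemma ratesD:
  assumes "rates I \<beta> \<gamma> \<theta>"
  shows "AE x in lborel. x \<in> {0<..<\<beta>} \<longrightarrow> in_SI I (\<theta> x) \<and>
        (\<forall>j\<le>Suc I. ((\<lambda>t. \<gamma> t j) has_real_derivative drift I (\<theta> x) j) (at x))"
  using assms by (simp add: rates_def)

lemma rates_SOME:
  assumes "valid I \<beta> \<gamma>"
  shows "rates I \<beta> \<gamma> (SOME \<theta>. rates I \<beta> \<gamma> \<theta>)"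
  using assms unfolding valid_def by (metis someI_ex)

text \<open>Partial sums of the drift recover the rates up to level \<open>I\<close>, and
  normalisation gives the overflow rate. Hence the choice by \<open>SOME\<close> in
  \<open>Jfun\<close> does not affect the integral.\<close>

lemma rates_AE_unique:
  assumes "rates I \<beta> \<gamma> \<theta>" "rates I \<beta> \<gamma> \<theta>'"
  shows "AE x in lborel. x \<in> {0<..<\<beta>} \<longrightarrow> (\<forall>j\<le>Suc I. \<theta> x j = \<theta>' x j)"
  using ratesD[OF assms(1)] ratesD[OF assms(2)]
proof eventually_elim
  case (elim x)
  show ?case
  proof
    assume x: "x \<in> {0<..<\<beta>}"
    have d: "drift I (\<theta> x) j = drift I (\<theta>' x) j" if "j \<le> Suc I" for j
      using elim x that DERIV_unique by blast
    have e: "\<theta> x i = \<theta>' x i" if i: "i \<le> I" for i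
    proof -
      have "(\<Sum>j\<le>i. drift I (\<theta> x) j) = (\<Sum>j\<le>i. drift I (\<theta>' x) j)"
        using d i by (intro sum.cong) auto
      then show ?thesis by (simp add: sum_drift i)
    qed
    have "(\<Sum>j\<le>I. \<theta> x j) = (\<Sum>j\<le>I. \<theta>' x j)" using e by (intro sum.cong) auto
    then have "\<theta> x (Suc I) = \<theta>' x (Suc I)" using elim x by (simp add: in_SI_def)
    then show "\<forall>j\<le>Suc I. \<theta> x j = \<theta>' x j" using e by (metis le_Suc_eq)
  qed
qed

lemma relent_cong:
  assumes "\<And>j. j \<le> Suc I \<Longrightarrow> t j = t' j"
  shows "relent I t g = relent I t' g"
proof -
  have "(\<exists>j\<le>Suc I. t j > 0 \<and> g j = 0) = (\<exists>j\<le>Suc I. t' j > 0 \<and> g j = 0)" using assms by auto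
  moreover have "(\<Sum>j\<le>Suc I. if t j = 0 then 0 else t j * ln (t j / g j))
    = (\<Sum>j\<le>Suc I. if t' j = 0 then 0 else t' j * ln (t' j / g j))"
    by (rule sum.cong) (auto simp: assms)
  ultimately show ?thesis by (simp only: relent_def)
qed

lemma Jfun_eq_nn_integral_rates:
  assumes "valid I \<beta> \<gamma>" "rates I \<beta> \<gamma> \<theta>"
  shows "Jfun I \<beta> \<gamma> = (\<integral>\<^sup>+ x \<in> {0..\<beta>}. e2ennreal (relent I (\<theta> x) (\<gamma> x)) \<partial>lborel)"
proof -
  have "AE x in lborel. x \<noteq> 0 \<and> x \<noteq> \<beta>"
    using AE_lborel_singleton[of 0] AE_lborel_singleton[of \<beta>] by eventually_elim auto
  then have "AE x in lborel. e2ennreal (relent I ((SOME \<theta>. rates I \<beta> \<gamma> \<theta>) x) (\<gamma> x)) * indicator {0..\<beta>} x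
      = e2ennreal (relent I (\<theta> x) (\<gamma> x)) * indicator {0..\<beta>} x"
    using rates_AE_unique[OF rates_SOME[OF assms(1)] assms(2)]
  proof eventually_elim
    case (elim x)
    show ?case
    proof (cases "x \<in> {0..\<beta>}")
      case True
      then have "x \<in> {0<..<\<beta>}" using elim by auto
      then show ?thesis using elim relent_cong by metis
    qed simp
  qed
  then show ?thesis using assms(1) by (simp add: Jfun_def nn_integral_cong_AE)
qed

section \<open>Regularity of competitors and rates forced to vanish\<close>

context
  fixes I :: nat and \<beta> :: real and \<alpha> \<omega> :: "nat \<Rightarrow> real" and \<gamma> \<theta> :: "real \<Rightarrow> nat \<Rightarrow> real"
  assumes \<gamma>: "\<gamma> \<in> Aset I \<alpha> \<omega> \<beta>" and \<theta>: "rates I \<beta> \<gamma> \<theta>"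
begin

lemma path_lipschitz_on:
  assumes j: "j \<le> Suc I"
  shows "1-lipschitz_on {0..\<beta>} (\<lambda>x. \<gamma> x j)"
proof (rule abs_cont_on_lipschitz_on[where g = "\<lambda>x. drift I (\<theta> x) j"])
  show "abs_cont_on 0 \<beta> (\<lambda>x. \<gamma> x j)" using \<gamma> j by (auto simp: Aset_def valid_def)
  show "AE x in lborel. x \<in> {0<..<\<beta>} \<longrightarrow>
      ((\<lambda>t. \<gamma> t j) has_real_derivative drift I (\<theta> x) j) (at x) \<and> \<bar>drift I (\<theta> x) j\<bar> \<le> 1"
    using ratesD[OF \<theta>] by eventually_elim (use j abs_drift_le_1 in auto)
qed simp

lemma path_sum_lipschitz_on:
  assumes "n \<le> Suc I"
  shows "\<exists>L. L-lipschitz_on {0..\<beta>} (\<lambda>x. \<Sum>j\<le>n. l j * \<gamma> x j)"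
proof (rule lipschitz_on_sum_real)
  fix j assume "j \<in> {..n}"
  then have "1-lipschitz_on {0..\<beta>} (\<lambda>x. \<gamma> x j)" using assms path_lipschitz_on by simp
  from lipschitz_on_cmult_real[OF this] show "\<exists>L. L-lipschitz_on {0..\<beta>} (\<lambda>x. l j * \<gamma> x j)" by blast
qed simp

text \<open>The mass at levels up to \<open>i\<close> starts at 1, can only decrease, and must end
  at 1 because \<omega> has nothing above \<open>i\<close>. So no mass ever leaves these
  levels.\<close>

lemma path_rate_eq_0_above_support:
  assumes i: "i \<le> I" and init: "\<alpha> = empty_init" and \<omega>: "in_SI I \<omega>"
    and z: "\<And>k. i < k \<Longrightarrow> k \<le> Suc I \<Longrightarrow> \<omega> k = 0"
  shows "AE x in lborel. x \<in> {0<..<\<beta>} \<longrightarrow> \<theta> x i = 0"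
proof -
  obtain L where "L-lipschitz_on {0..\<beta>} (\<lambda>x. \<Sum>j\<le>i. - 1 * \<gamma> x j)"
    using path_sum_lipschitz_on[of i "\<lambda>_. - 1"] i by auto
  then have ac: "abs_cont_on 0 \<beta> (\<lambda>x. \<Sum>j\<le>i. - 1 * \<gamma> x j)" by (rule abs_cont_on_lipschitz)
  have der: "AE x in lborel. x \<in> {0<..<\<beta>} \<longrightarrow>
      ((\<lambda>x. \<Sum>j\<le>i. - 1 * \<gamma> x j) has_real_derivative \<theta> x i) (at x) \<and> 0 \<le> \<theta> x i"
    using ratesD[OF \<theta>]
  proof eventually_elim
    case (elim x)
    have "((\<lambda>x. \<Sum>j\<le>i. - 1 * \<gamma> x j) has_real_derivative (\<Sum>j\<le>i. - 1 * drift I (\<theta> x) j)) (at x)"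
      if "x \<in> {0<..<\<beta>}"
      using elim that i by (intro DERIV_sum DERIV_cmult) auto
    moreover have "(\<Sum>j\<le>i. - 1 * drift I (\<theta> x) j) = \<theta> x i"
      using sum_drift[OF i] by (simp add: sum_negf)
    ultimately show ?case using elim i by (auto simp: in_SI_def)
  qed
  have "(\<Sum>j\<le>i. \<gamma> 0 j) = (\<Sum>j\<le>i. empty_init j)"
    using AsetD(3)[OF \<gamma>] i init by (intro sum.cong) auto
  also have "\<dots> = 1" by (simp add: empty_init_def)
  also have "\<dots> = (\<Sum>j\<le>Suc I. \<omega> j)" using \<omega> by (simp add: in_SI_def)
  also have "\<dots> = (\<Sum>j\<le>i. \<omega> j)" using z i by (intro sum.mono_neutral_right) auto
  also have "\<dots> = (\<Sum>j\<le>i. \<gamma> \<beta> j)" using AsetD(4)[OF \<gamma>] i by (intro sum.cong) auto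
  finally show ?thesis
    by (intro abs_cont_on_derivative_eq_0[OF ac der]) (simp add: sum_negf)
qed

text \<open>\<open>x - (\<Sum>j\<le>Suc I. real j * \<gamma> x j)\<close> counts the balls thrown
  into urns that had already overflowed. It starts at 0, never decreases, and tightness makes it end
  at 0.\<close>

lemma path_overflow_rate_eq_0_if_tight:
  assumes init: "\<alpha> = empty_init" and tight: "tight I \<omega> \<beta>"
  shows "AE x in lborel. x \<in> {0<..<\<beta>} \<longrightarrow> \<theta> x (Suc I) = 0"
proof -
  let ?f = "\<lambda>x. x - (\<Sum>j\<le>Suc I. real j * \<gamma> x j)"
  obtain L where "L-lipschitz_on {0..\<beta>} (\<lambda>x. \<Sum>j\<le>Suc I. real j * \<gamma> x j)"
    using path_sum_lipschitz_on[of "Suc I" real] by auto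
  then have ac: "abs_cont_on 0 \<beta> ?f"
    by (rule abs_cont_on_lipschitz[OF lipschitz_on_diff[OF lipschitz_on_id]])
  have der: "AE x in lborel. x \<in> {0<..<\<beta>} \<longrightarrow>
      (?f has_real_derivative \<theta> x (Suc I)) (at x) \<and> 0 \<le> \<theta> x (Suc I)"
    using ratesD[OF \<theta>]
  proof eventually_elim
    case (elim x)
    show ?case
    proof
      assume x: "x \<in> {0<..<\<beta>}"
      have "(?f has_real_derivative 1 - (\<Sum>j\<le>Suc I. real j * drift I (\<theta> x) j)) (at x)"
        using elim x by (intro DERIV_diff DERIV_sum DERIV_cmult DERIV_ident) auto
      moreover have "1 - (\<Sum>j\<le>Suc I. real j * drift I (\<theta> x) j) = \<theta> x (Suc I)"
        using sum_drift_mult[of I "\<theta> x" real] elim x by (simp add: in_SI_def mult.commute)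
      ultimately show "(?f has_real_derivative \<theta> x (Suc I)) (at x) \<and> 0 \<le> \<theta> x (Suc I)"
        using elim x by (simp add: in_SI_def)
    qed
  qed
  have "(\<Sum>j\<le>Suc I. real j * \<gamma> 0 j) = 0"
    using AsetD(3)[OF \<gamma>] init by (intro sum.neutral) (auto simp: empty_init_def)
  moreover have "(\<Sum>j\<le>Suc I. real j * \<gamma> \<beta> j) = (\<Sum>j\<le>Suc I. real j * \<omega> j)"
    using AsetD(4)[OF \<gamma>] by (intro sum.cong) auto
  ultimately show ?thesis
    using tight by (intro abs_cont_on_derivative_eq_0[OF ac der]) (simp add: tight_def)
qed

end

section \<open>The extremal path\<close>

text \<open>The product-rule terms telescope, leaving only the integrand of the Taylor remainder.
  With \<open>H = G\<close> this gives the rates of the candidate; with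
  \<open>H j = G (Suc j)\<close> it gives the derivative of their sum.\<close>

lemma has_real_derivative_taylor_sum:
  fixes H :: "nat \<Rightarrow> real \<Rightarrow> real"
  assumes "\<And>j. j \<le> n \<Longrightarrow> (H j has_real_derivative - H (Suc j) x) (at x)"
  shows "((\<lambda>x. \<Sum>j\<le>n. x ^ j / fact j * H j x) has_real_derivative - (x ^ n / fact n * H (Suc n) x)) (at x)"
  using assms
proof (induction n)
  case 0
  then show ?case by simp
next
  case (Suc n)
  have "((\<lambda>x. x ^ Suc n / fact (Suc n)) has_real_derivative real (Suc n) * x ^ n / fact (Suc n)) (at x)"
    using DERIV_cdivide[OF DERIV_pow[of "Suc n" x UNIV], of "fact (Suc n)"] by simp
  moreover have "real (Suc n) * x ^ n / fact (Suc n) = x ^ n / fact n"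
    by (simp add: divide_simps)
  ultimately have p: "((\<lambda>x. x ^ Suc n / fact (Suc n)) has_real_derivative x ^ n / fact n) (at x)" by metis
  have "((\<lambda>x. \<Sum>j\<le>n. x ^ j / fact j * H j x) has_real_derivative - (x ^ n / fact n * H (Suc n) x)) (at x)"
    using Suc by simp
  from DERIV_add[OF this DERIV_mult[OF p Suc.prems[OF order_refl]]]
  show ?case by (simp add: mult.commute del: power_Suc fact_Suc)
qed

lemma taylor_sum_at_0:
  fixes h :: "nat \<Rightarrow> real"
  shows "(\<Sum>j\<le>n. 0 ^ j / fact j * h j) = h 0"
  by (induction n) auto

text \<open>\<open>G j\<close> is \<open>(-1)\<^sup>j\<close> times the \<open>j\<close>-th derivative of the optimal \<open>\<gamma>\<^sub>0\<close>, and \<open>\<sigma>\<close> is the constant ratio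
  of rate to occupancy at the overflow level: the twist parameter \<open>\<rho>\<close>, or \<open>0\<close> in the tight case.\<close>

locale extremal =
  fixes I :: nat and \<beta> \<sigma> :: real and \<omega> :: "nat \<Rightarrow> real" and G :: "nat \<Rightarrow> real \<Rightarrow> real"
  assumes \<beta>_pos: "0 < \<beta>" and \<omega>: "in_SI I \<omega>"
    and G_deriv: "\<And>j x. j \<le> Suc I \<Longrightarrow> (G j has_real_derivative - G (Suc j) x) (at x)"
    and G_top: "\<And>x. G (Suc (Suc I)) x = \<sigma> * G (Suc I) x"
    and \<sigma>_nonneg: "0 \<le> \<sigma>"
    and top_dichotomy: "(\<forall>x\<in>{0..\<beta>}. G (Suc I) x = 0) \<and> \<sigma> = 0 \<or> (\<exists>c>0. \<forall>x\<in>{0..\<beta>}. c \<le> G (Suc I) x)"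
    and G_0_0: "G 0 0 = 1" and G_1_0: "G (Suc 0) 0 = 1"
    and G_end: "\<And>j. j \<le> I \<Longrightarrow> \<beta> ^ j / fact j * G j \<beta> = \<omega> j"
    and G_top_end: "G (Suc I) \<beta> = 0 \<Longrightarrow> \<omega> (Suc I) = 0"
    and tight: "\<sigma> = 0 \<Longrightarrow> tight I \<omega> \<beta>"
begin

section \<open>Sign and lower bounds of the functions \<open>G j\<close>\<close>

lemma continuous_on_G:
  assumes "j \<le> Suc (Suc I)"
  shows "continuous_on S (G j)"
proof -
  have *: "continuous_on S (G j)" if "j \<le> Suc I" for j
    using G_deriv[OF that] by (intro continuous_at_imp_continuous_on ballI DERIV_isCont)
  show ?thesis
  proof (cases "j = Suc (Suc I)")
    case True
    then show ?thesis using *[of "Suc I"] G_top by (simp add: continuous_on_mult_left)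
  qed (use * assms in auto)
qed

lemma G_end_nonneg: "j \<le> I \<Longrightarrow> 0 \<le> G j \<beta>"
  using G_end[of j] \<omega> \<beta>_pos
  by (metis divide_pos_pos fact_gt_zero in_SI_def le_SucI zero_le_mult_iff zero_less_power not_less)

text \<open>Downward induction from the top level. If \<open>G (Suc n)\<close> vanishes, then
  \<open>G n\<close> is constant, equal to its nonnegative end value. A lower bound
  \<open>c * (\<beta> - x) ^ m\<close> on \<open>G (Suc n)\<close> integrates backwards from \<beta>
  to one for \<open>G n\<close> with exponent \<open>Suc m\<close>. The polynomial rate keeps the
  singularity of \<open>ln (G j x)\<close> at \<beta> logarithmic.\<close>

lemma G_zero_or_bound:
  assumes "j \<le> Suc I"
  shows "(\<forall>k. j \<le> k \<longrightarrow> k \<le> Suc I \<longrightarrow> (\<forall>x\<in>{0..\<beta>}. G k x = 0)) \<or>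
    (\<exists>c>0. \<exists>m. \<forall>x\<in>{0..\<beta>}. c * (\<beta> - x) ^ m \<le> G j x)"
  using assms
proof (induction rule: inc_induct)
  case base
  show ?case using top_dichotomy
  proof
    assume "\<exists>c>0. \<forall>x\<in>{0..\<beta>}. c \<le> G (Suc I) x"
    then obtain c where c: "c > 0" "\<forall>x\<in>{0..\<beta>}. c \<le> G (Suc I) x" by blast
    then have "\<forall>x\<in>{0..\<beta>}. c * (\<beta> - x) ^ 0 \<le> G (Suc I) x" by simp
    then show ?thesis using c(1) by blast
  qed (use le_antisym in blast)
next
  case (step n)
  have n: "n \<le> I" using step by simp
  from step.IH show ?case
  proof
    assume z: "\<forall>k. Suc n \<le> k \<longrightarrow> k \<le> Suc I \<longrightarrow> (\<forall>x\<in>{0..\<beta>}. G k x = 0)"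
    have "(G n has_real_derivative 0) (at x within {0..\<beta>})" if "x \<in> {0..\<beta>}" for x
      using G_deriv[of n x] z n that by (auto intro: has_field_derivative_at_within)
    then obtain c where c: "\<And>x. x \<in> {0..\<beta>} \<Longrightarrow> G n x = c"
      using has_field_derivative_zero_constant[of "{0..\<beta>}" "G n"] by auto
    have "c = G n \<beta>" using c[of \<beta>] \<beta>_pos by simp
    then have "0 \<le> c" using G_end_nonneg[OF n] by simp
    show ?thesis
    proof (cases "c = 0")
      case True
      then show ?thesis using z c by (metis not_less_eq_eq order_antisym)
    next
      case False
      then have "c > 0" using \<open>0 \<le> c\<close> by simp
      moreover have "\<forall>x\<in>{0..\<beta>}. c * (\<beta> - x) ^ 0 \<le> G n x" using c by simp
      ultimately show ?thesis by blast
    qed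
  next
    assume "\<exists>c>0. \<exists>m. \<forall>x\<in>{0..\<beta>}. c * (\<beta> - x) ^ m \<le> G (Suc n) x"
    then obtain c m where c: "c > 0" "\<And>x. x \<in> {0..\<beta>} \<Longrightarrow> c * (\<beta> - x) ^ m \<le> G (Suc n) x" by blast
    define h where "h x = G n x - c / real (Suc m) * (\<beta> - x) ^ Suc m" for x
    have "c / real (Suc m) * (\<beta> - x) ^ Suc m \<le> G n x" if x: "x \<in> {0..\<beta>}" for x
    proof -
      have "h \<beta> \<le> h x"
      proof (rule DERIV_nonpos_imp_nonincreasing[where f = h])
        fix y assume y: "x \<le> y" "y \<le> \<beta>"
        have "(h has_real_derivative - G (Suc n) y + c * (\<beta> - y) ^ m) (at y)"
          unfolding h_def using n
          by (auto intro!: derivative_eq_intros G_deriv simp del: power_Suc of_nat_Suc)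
        moreover have "- G (Suc n) y + c * (\<beta> - y) ^ m \<le> 0" using c(2)[of y] x y by simp
        ultimately show "\<exists>D. (h has_real_derivative D) (at y) \<and> D \<le> 0" by blast
      qed (use x in simp)
      then show ?thesis using G_end_nonneg[OF n] by (simp add: h_def)
    qed
    moreover have "c / real (Suc m) > 0" using c(1) by simp
    ultimately show ?thesis by blast
  qed
qed

lemma G_pos_or_zero:
  assumes "j \<le> Suc I"
  obtains (zero) "\<And>k x. j \<le> k \<Longrightarrow> k \<le> Suc I \<Longrightarrow> x \<in> {0..\<beta>} \<Longrightarrow> G k x = 0"
    | (pos) c m where "c > 0" "\<And>x. x \<in> {0..\<beta>} \<Longrightarrow> c * (\<beta> - x) ^ m \<le> G j x" "\<And>x. x \<in> {0..<\<beta>} \<Longrightarrow> 0 < G j x"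
proof -
  from G_zero_or_bound[OF assms] show ?thesis
  proof
    assume "\<exists>c>0. \<exists>m. \<forall>x\<in>{0..\<beta>}. c * (\<beta> - x) ^ m \<le> G j x"
    then obtain c m where c: "c > 0" "\<And>x. x \<in> {0..\<beta>} \<Longrightarrow> c * (\<beta> - x) ^ m \<le> G j x" by blast
    have "0 < G j x" if x: "x \<in> {0..<\<beta>}" for x
    proof -
      have "0 < c * (\<beta> - x) ^ m" using c x by simp
      then show ?thesis using c(2)[of x] x by simp
    qed
    then show ?thesis using pos c by blast
  qed (use zero in blast)
qed

lemma G_nonneg:
  assumes "j \<le> Suc I" "x \<in> {0..\<beta>}"
  shows "0 \<le> G j x"
  using assms(1)
proof (cases rule: G_pos_or_zero)
  case (pos c m)
  have "0 \<le> c * (\<beta> - x) ^ m" using pos(1) assms by simp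
  then show ?thesis using pos(2)[OF assms(2)] by linarith
qed (use assms in simp)

text \<open>Before \<beta>, a single zero of \<open>G j\<close> rules out the positive alternative.
  Consequently a zero denominator in \<open>ratio\<close> comes with a zero numerator, and the
  default value \<open>0 / 0 = 0\<close> is the right one.\<close>

lemma G_Suc_eq_0_if_eq_0:
  assumes "j \<le> Suc I" "x \<in> {0..<\<beta>}" "G j x = 0"
  shows "G (Suc j) x = 0"
  using assms(1)
proof (cases rule: G_pos_or_zero)
  case zero
  show ?thesis
  proof (cases "j = Suc I")
    case True
    then show ?thesis using assms G_top by simp
  qed (use assms in \<open>auto intro!: zero\<close>)
qed (use assms in fastforce)

lemma \<omega>_eq_0_if_G_end_eq_0:
  assumes "j \<le> Suc I" "G j \<beta> = 0"
  shows "\<omega> j = 0"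
  using assms G_end[of j] G_top_end by (cases "j = Suc I") auto

section \<open>The candidate path and its membership in the constraint set\<close>

definition ratio :: "nat \<Rightarrow> real \<Rightarrow> real" where
  "ratio j x = G (Suc j) x / G j x"

definition opt :: "real \<Rightarrow> nat \<Rightarrow> real" where
  "opt x j = (if j \<le> I then x ^ j / fact j * G j x
     else if j = Suc I then 1 - (\<Sum>i\<le>I. x ^ i / fact i * G i x) else 0)"

definition optrate :: "real \<Rightarrow> nat \<Rightarrow> real" where
  "optrate x j = (if j \<le> I then x ^ j / fact j * G (Suc j) x
     else if j = Suc I then \<sigma> * opt x (Suc I) else 0)"

lemma ratio_nonneg: "j \<le> Suc I \<Longrightarrow> x \<in> {0..\<beta>} \<Longrightarrow> 0 \<le> ratio j x"
  using G_nonneg[of j x] G_nonneg[of "Suc j" x] G_nonneg[of "Suc I" x] G_top[of x] \<sigma>_nonneg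
  by (cases "j = Suc I") (auto simp: ratio_def)

lemma ratio_top:
  assumes "x \<in> {0..<\<beta>}"
  shows "ratio (Suc I) x = \<sigma>"
  using top_dichotomy assms G_top[of x] by (force simp: ratio_def)

lemma opt_cumulative_deriv:
  assumes "i \<le> I"
  shows "((\<lambda>x. \<Sum>j\<le>i. opt x j) has_real_derivative - optrate x i) (at x)"
proof -
  have "(\<lambda>x. \<Sum>j\<le>i. opt x j) = (\<lambda>x. \<Sum>j\<le>i. x ^ j / fact j * G j x)"
    using assms by (auto simp: opt_def fun_eq_iff intro!: sum.cong)
  then show ?thesis
    using has_real_derivative_taylor_sum[of i G x] G_deriv assms by (simp add: optrate_def)
qed

lemma opt_overflow: "opt x (Suc I) = 1 - (\<Sum>j\<le>I. opt x j)"
  by (auto simp: opt_def intro!: sum.cong)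

lemma opt_deriv:
  assumes "j \<le> Suc I"
  shows "((\<lambda>x. opt x j) has_real_derivative drift I (optrate x) j) (at x)"
proof (cases j)
  case 0
  then show ?thesis using opt_cumulative_deriv[of 0 x] by (simp add: drift_def)
next
  case (Suc i)
  show ?thesis
  proof (cases "j = Suc I")
    case True
    have "((\<lambda>x. 1 - (\<Sum>j\<le>I. opt x j)) has_real_derivative 0 - - optrate x I) (at x)"
      by (intro DERIV_diff DERIV_const opt_cumulative_deriv order_refl)
    then show ?thesis using True by (simp add: opt_overflow drift_def)
  next
    case False
    then have j: "j \<le> I" using assms by simp
    have "((\<lambda>x. (\<Sum>j\<le>j. opt x j) - (\<Sum>j\<le>i. opt x j)) has_real_derivative - optrate x j - - optrate x i) (at x)"
      by (intro DERIV_diff opt_cumulative_deriv) (use j Suc in auto)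
    then show ?thesis using Suc j by (simp add: drift_def)
  qed
qed

lemma opt_0: "j \<le> Suc I \<Longrightarrow> opt 0 j = empty_init j"
  using taylor_sum_at_0[of "\<lambda>i. G i 0" I] G_0_0 by (auto simp: opt_def empty_init_def power_0_left)

lemma opt_\<beta>:
  assumes "j \<le> Suc I"
  shows "opt \<beta> j = \<omega> j"
proof -
  have *: "opt \<beta> i = \<omega> i" if "i \<le> I" for i
    using that by (simp only: opt_def G_end if_True)
  have "(\<Sum>i\<le>I. opt \<beta> i) = (\<Sum>i\<le>I. \<omega> i)" using * by (intro sum.cong) auto
  then have "opt \<beta> (Suc I) = \<omega> (Suc I)" using \<omega> opt_overflow[of \<beta>] by (simp add: in_SI_def)
  then show ?thesis using assms * by (metis le_Suc_eq)
qed

text \<open>The overflow rate in \<open>optrate\<close> is prescribed as \<sigma> times the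
  occupancy, so that the rates sum to 1 needs proof. By \<open>G_top\<close> the derivative of the
  total is zero, and \<open>G_0_0\<close> and \<open>G_1_0\<close> make the total 1 at 0.\<close>

lemma sum_optrate: "(\<Sum>j\<le>Suc I. optrate x j) = 1"
proof -
  define f where "f x = (\<Sum>j\<le>I. x ^ j / fact j * G (Suc j) x) + \<sigma> * (1 - (\<Sum>j\<le>I. x ^ j / fact j * G j x))" for x
  have "(f has_real_derivative
      - (x ^ I / fact I * G (Suc (Suc I)) x) + \<sigma> * (0 - - (x ^ I / fact I * G (Suc I) x))) (at x)" for x
    unfolding f_def
    by (intro DERIV_add DERIV_cmult DERIV_diff DERIV_const has_real_derivative_taylor_sum G_deriv
        has_real_derivative_taylor_sum[of I "\<lambda>j. G (Suc j)"]) auto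
  then have "(f has_real_derivative 0) (at x)" for x by (simp add: G_top)
  then have "f x = f 0" using DERIV_isconst_all by blast
  also have "\<dots> = 1"
    unfolding f_def taylor_sum_at_0 using G_0_0 G_1_0 by simp
  finally have "f x = 1" .
  moreover have "(\<Sum>j\<le>I. optrate x j) = (\<Sum>j\<le>I. x ^ j / fact j * G (Suc j) x)"
    by (intro sum.cong) (auto simp: optrate_def)
  ultimately show ?thesis by (simp add: f_def optrate_def opt_def)
qed

lemma optrate_nonneg:
  assumes "x \<in> {0..\<beta>}" "j \<le> I"
  shows "0 \<le> optrate x j"
  using assms G_nonneg[of "Suc j" x] by (simp add: optrate_def)

lemma opt_overflow_nonneg:
  assumes x: "x \<in> {0..\<beta>}"
  shows "0 \<le> opt x (Suc I)"
proof -
  have "opt 0 (Suc I) \<le> opt x (Suc I)"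
  proof (rule DERIV_nonneg_imp_nondecreasing[where f = "\<lambda>x. opt x (Suc I)"])
    fix y assume "0 \<le> y" "y \<le> x"
    then have "0 \<le> drift I (optrate y) (Suc I)" using x optrate_nonneg[of y I] by (simp add: drift_def)
    then show "\<exists>D. ((\<lambda>x. opt x (Suc I)) has_real_derivative D) (at y) \<and> 0 \<le> D"
      using opt_deriv by blast
  qed (use x in simp)
  then show ?thesis by (simp add: opt_0 empty_init_def)
qed

lemma in_SI_opt: "x \<in> {0..\<beta>} \<Longrightarrow> in_SI I (opt x)"
  using opt_overflow_nonneg[of x] G_nonneg[of _ x]
  by (auto simp: in_SI_def opt_overflow le_Suc_eq) (simp add: opt_def)

lemma in_SI_optrate: "x \<in> {0..\<beta>} \<Longrightarrow> in_SI I (optrate x)"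
  using opt_overflow_nonneg[of x] optrate_nonneg[of x] \<sigma>_nonneg sum_optrate[of x]
  by (auto simp: in_SI_def le_Suc_eq) (simp add: optrate_def)

lemma continuous_on_opt: "continuous_on S (\<lambda>x. opt x j)"
proof (cases "j \<le> Suc I")
  case True
  then show ?thesis using opt_deriv by (intro continuous_at_imp_continuous_on ballI DERIV_isCont)
qed (simp add: opt_def)

lemma continuous_on_optrate: "continuous_on S (\<lambda>x. optrate x j)"
proof -
  consider "j \<le> I" | "j = Suc I" | "Suc I < j" by linarith
  then show ?thesis
  proof cases
    case 1
    then show ?thesis using continuous_on_G[of "Suc j" S]
      by (simp add: optrate_def) (intro continuous_intros, auto)
  next
    case 2
    then show ?thesis using continuous_on_opt[of S "Suc I"]
      by (simp add: optrate_def) (intro continuous_intros, auto)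
  qed (simp add: optrate_def)
qed

lemma rates_opt: "rates I \<beta> opt optrate"
  unfolding rates_def
  using continuous_on_optrate in_SI_optrate opt_deriv
  by (auto intro!: borel_measurable_continuous_onI)

lemma opt_in_Aset: "opt \<in> Aset I empty_init \<omega> \<beta>"
proof -
  have "abs_cont_on 0 \<beta> (\<lambda>x. opt x j)" if j: "j \<le> Suc I" for j
  proof -
    have "continuous_on {0..\<beta>} (\<lambda>x. drift I (optrate x) j)"
      unfolding drift_def
      by (cases "j = 0"; cases "j \<le> I")
        (auto intro!: continuous_on_minus continuous_on_diff continuous_on_optrate)
    then obtain L where "L-lipschitz_on {0..\<beta>} (\<lambda>x. opt x j)"
      using lipschitz_on_C1[of 0 \<beta>, OF opt_deriv[OF j]] by blast
    then show ?thesis by (rule abs_cont_on_lipschitz)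
  qed
  then show ?thesis
    using in_SI_opt rates_opt opt_0 opt_\<beta> by (auto simp: Aset_def valid_def)
qed

lemma optrate_eq_ratio:
  assumes x: "x \<in> {0..<\<beta>}" and j: "j \<le> Suc I"
  shows "optrate x j = ratio j x * opt x j"
proof (cases "j = Suc I")
  case True
  then show ?thesis using ratio_top[OF x] by (simp add: optrate_def)
next
  case False
  then show ?thesis using j G_Suc_eq_0_if_eq_0[OF j x]
    by (cases "G j x = 0") (auto simp: optrate_def opt_def ratio_def)
qed

end

section \<open>The tangent bound and its integral\<close>

lemma tendsto_mult_ln_at_right_0: "((\<lambda>t::real. t * ln t) \<longlongrightarrow> 0) (at_right 0)"
proof (rule Lim_null_comparison)
  show "\<forall>\<^sub>F t in at_right (0::real). norm (t * ln t) \<le> 2 * sqrt t"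
  proof -
    have "\<forall>\<^sub>F t in at_right (0::real). t \<in> {0<..<1}" by (rule eventually_at_right_real) simp
    then show ?thesis
    proof eventually_elim
      case (elim t)
      \<comment> \<open>Applying \<open>ln u \<le> u - 1\<close> to \<open>u = 1 / sqrt t\<close>,
        rather than to \<open>1 / t\<close>, leaves a factor \<open>sqrt t\<close> that tends to
        0.\<close>
      have "- ln t = 2 * ln (1 / sqrt t)" using elim by (simp add: ln_div ln_sqrt)
      also have "\<dots> \<le> 2 * (1 / sqrt t)" using elim ln_le_minus_one[of "1 / sqrt t"] by simp
      finally have "t * (- ln t) \<le> t * (2 * (1 / sqrt t))" using elim by (intro mult_left_mono) auto
      also have "\<dots> = 2 * sqrt t" using elim by (simp add: field_simps real_sqrt_mult_self)
      finally show ?case using elim by (simp add: abs_mult)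
    qed
  qed
  show "((\<lambda>t. 2 * sqrt t) \<longlongrightarrow> 0) (at_right 0)"
    by (auto intro!: tendsto_eq_intros)
qed

section \<open>The calibrating potential and its behaviour at the end point\<close>

context extremal
begin

text \<open>In the vanishing alternative the formula survives through default values:
  \<open>ln 0 = 0\<close> is constant and the ratio is 0.\<close>

lemma ln_G_deriv:
  assumes j: "j \<le> Suc I" and x: "x \<in> {0<..<\<beta>}"
  shows "((\<lambda>x. ln (G j x)) has_real_derivative - ratio j x) (at x)"
  using j
proof (cases rule: G_pos_or_zero)
  case zero
  have "((\<lambda>x. ln (G j x)) has_real_derivative 0) (at x)"
    by (rule has_field_derivative_transform_within_open[of "\<lambda>_. 0" _ _ "{0<..<\<beta>}"])
      (use x j zero in auto)
  moreover have "G j x = 0" using zero x j by simp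
  ultimately show ?thesis by (simp add: ratio_def)
next
  case (pos c m)
  have "G j x > 0" using pos x by simp
  then show ?thesis using G_deriv[OF j, of x]
    by (auto intro!: derivative_eq_intros simp: ratio_def)
qed

lemma ln_G_lipschitz_on:
  assumes j: "j \<le> Suc I" and b: "b < \<beta>"
  shows "\<exists>L. L-lipschitz_on {0..b} (\<lambda>x. ln (G j x))"
  using j
proof (cases rule: G_pos_or_zero)
  case zero
  have "0-lipschitz_on {0..b} (\<lambda>x. ln (G j x))"
    by (rule lipschitz_on_transform[OF lipschitz_on_constant[of _ 0]]) (use zero b j in auto)
  then show ?thesis by blast
next
  case (pos c m)
  have p: "G j x > 0" if "x \<in> {0..b}" for x using pos that b by simp
  show ?thesis
  proof (rule lipschitz_on_C1[where f' = "\<lambda>x. - ratio j x"])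
    show "((\<lambda>x. ln (G j x)) has_real_derivative - ratio j x) (at x)" if "x \<in> {0..b}" for x
      using G_deriv[OF j, of x] p[OF that]
      by (auto intro!: derivative_eq_intros simp: ratio_def)
    show "continuous_on {0..b} (\<lambda>x. - ratio j x)"
      unfolding ratio_def using p j
      by (intro continuous_on_minus continuous_on_divide continuous_on_G) force+
  qed
qed

definition potential :: "(real \<Rightarrow> nat \<Rightarrow> real) \<Rightarrow> real \<Rightarrow> real" where
  "potential \<gamma> x = x + (\<Sum>j\<le>Suc I. \<gamma> x j * ln (G j x)) + ln \<sigma> * (x - (\<Sum>j\<le>Suc I. real j * \<gamma> x j))"

definition tangent :: "(real \<Rightarrow> nat \<Rightarrow> real) \<Rightarrow> (real \<Rightarrow> nat \<Rightarrow> real) \<Rightarrow> real \<Rightarrow> real" where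
  "tangent \<gamma> \<theta> x = 1 + (\<Sum>j\<le>Suc I. \<theta> x j * ln (ratio j x) - \<gamma> x j * ratio j x)"

text \<open>The common limit at \<beta> of the potentials of all competitors. Where
  \<open>G j \<beta> = 0\<close>, also \<open>\<omega> j = 0\<close>, so the default value of the
  logarithm has no influence.\<close>

definition end_value :: real where
  "end_value = \<beta> + (\<Sum>j\<le>Suc I. \<omega> j * ln (G j \<beta>)) + ln \<sigma> * (\<beta> - (\<Sum>j\<le>Suc I. real j * \<omega> j))"

context
  fixes \<gamma> \<theta> :: "real \<Rightarrow> nat \<Rightarrow> real"
  assumes \<gamma>: "\<gamma> \<in> Aset I empty_init \<omega> \<beta>" and \<theta>: "rates I \<beta> \<gamma> \<theta>"
begin

text \<open>The side condition of \<open>relent_ge_tangent\<close> for an arbitrary competitor. A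
  zero ratio occurs only at the overflow level of the tight case, or at a level \<open>j\<close>
  with \<open>G (Suc j)\<close> identically zero; then \<omega> is zero above \<open>j\<close>, and
  the boundary constraint stops the flow.\<close>

lemma rate_eq_0_if_ratio_eq_0:
  "AE x in lborel. \<forall>j\<in>{..Suc I}. x \<in> {0<..<\<beta>} \<longrightarrow> ratio j x = 0 \<longrightarrow> \<theta> x j = 0"
proof (rule AE_finite_allI)
  fix j assume "j \<in> {..Suc I}"
  then have j: "j \<le> Suc I" by simp
  show "AE x in lborel. x \<in> {0<..<\<beta>} \<longrightarrow> ratio j x = 0 \<longrightarrow> \<theta> x j = 0"
  proof (cases "j = Suc I")
    case True
    show ?thesis
    proof (cases "\<sigma> = 0")
      case \<sigma>: True
      show ?thesis using path_overflow_rate_eq_0_if_tight[OF \<gamma> \<theta> refl tight[OF \<sigma>]]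
        by eventually_elim (simp add: True)
    next
      case False
      then show ?thesis using True ratio_top by (intro AE_I2) auto
    qed
  next
    case False
    then have i: "j \<le> I" using j by simp
    then have "Suc j \<le> Suc I" by simp
    then show ?thesis
    proof (cases rule: G_pos_or_zero)
      case zero
      have z: "\<omega> k = 0" if "j < k" "k \<le> Suc I" for k
        using that \<beta>_pos by (intro \<omega>_eq_0_if_G_end_eq_0 zero) auto
      have "AE x in lborel. x \<in> {0<..<\<beta>} \<longrightarrow> \<theta> x j = 0"
        using path_rate_eq_0_above_support[OF \<gamma> \<theta> i refl \<omega>] z by blast
      then show ?thesis by eventually_elim simp
    next
      case (pos c m)
      have "ratio j x \<noteq> 0" if "x \<in> {0<..<\<beta>}" for x
        using pos(3)[of x] G_Suc_eq_0_if_eq_0[OF j, of x] that by (auto simp: ratio_def)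
      then show ?thesis by (intro AE_I2) auto
    qed
  qed
qed simp

text \<open>Differentiating \<open>ln (G j x)\<close> gives the terms with
  \<open>- ratio j x\<close>. Summation by parts turns the drift terms into logarithms of ratios for
  levels up to \<open>I\<close>, and the term with \<open>ln \<sigma>\<close> supplies the overflow
  level.\<close>

lemma potential_deriv:
  "AE x in lborel. x \<in> {0<..<\<beta>} \<longrightarrow> (potential \<gamma> has_real_derivative tangent \<gamma> \<theta> x) (at x)"
  using ratesD[OF \<theta>] rate_eq_0_if_ratio_eq_0
proof eventually_elim
  case (elim x)
  show ?case
  proof
    assume x: "x \<in> {0<..<\<beta>}"
    then have SI: "in_SI I (\<theta> x)"
      and der: "\<And>j. j \<le> Suc I \<Longrightarrow> ((\<lambda>t. \<gamma> t j) has_real_derivative drift I (\<theta> x) j) (at x)"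
      using elim by auto
    have 1: "(potential \<gamma> has_real_derivative
       1 + (\<Sum>j\<le>Suc I. drift I (\<theta> x) j * ln (G j x) + - ratio j x * \<gamma> x j) +
       ln \<sigma> * (1 - (\<Sum>j\<le>Suc I. real j * drift I (\<theta> x) j))) (at x)"
      unfolding potential_def using x der ln_G_deriv
      by (intro DERIV_add DERIV_sum DERIV_cmult DERIV_diff DERIV_ident DERIV_mult) auto
    \<comment> \<open>A nonzero rate forces a nonzero ratio, so both \<open>G\<close> are positive
      and the logarithm of the quotient splits; a zero rate annihilates both sides, whatever the
      logarithms are.\<close>
    have ln_ratio: "\<theta> x i * (ln (G (Suc i) x) - ln (G i x)) = \<theta> x i * ln (ratio i x)" if i: "i \<le> I" for i
    proof (cases "\<theta> x i = 0")
      case False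
      then have "ratio i x \<noteq> 0" using elim x i by auto
      then have "G i x \<noteq> 0" "G (Suc i) x \<noteq> 0" by (auto simp: ratio_def)
      then have "0 < G i x" "0 < G (Suc i) x"
        using G_nonneg[of i x] G_nonneg[of "Suc i" x] i x by auto
      then show ?thesis by (simp add: ratio_def ln_div)
    qed simp
    have "(\<Sum>j\<le>Suc I. drift I (\<theta> x) j * ln (G j x)) = (\<Sum>i\<le>I. \<theta> x i * ln (ratio i x))"
      unfolding sum_drift_mult using ln_ratio by (intro sum.cong) auto
    moreover have "1 - (\<Sum>j\<le>Suc I. real j * drift I (\<theta> x) j) = \<theta> x (Suc I)"
      using sum_drift_mult[of I "\<theta> x" real] SI by (simp add: in_SI_def mult.commute)
    moreover have "ratio (Suc I) x = \<sigma>" using ratio_top x by simp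
    ultimately have "1 + (\<Sum>j\<le>Suc I. drift I (\<theta> x) j * ln (G j x) + - ratio j x * \<gamma> x j) +
       ln \<sigma> * (1 - (\<Sum>j\<le>Suc I. real j * drift I (\<theta> x) j)) = tangent \<gamma> \<theta> x"
      unfolding tangent_def sum.distrib sum_subtractf
      by (simp add: sum_negf mult.commute)
    then show "(potential \<gamma> has_real_derivative tangent \<gamma> \<theta> x) (at x)" using 1 by simp
  qed
qed

lemma potential_lipschitz_on:
  assumes b: "b < \<beta>"
  shows "\<exists>L. L-lipschitz_on {0..b} (potential \<gamma>)"
proof -
  have sub: "{0..b} \<subseteq> {0..\<beta>}" using b by auto
  have "\<exists>L. L-lipschitz_on {0..b} (\<lambda>x. \<gamma> x j * ln (G j x))" if j: "j \<le> Suc I" for j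
    using ln_G_lipschitz_on[OF j b] lipschitz_on_subset[OF path_lipschitz_on[OF \<gamma> \<theta> j] sub]
    by (auto intro: lipschitz_on_mult_real)
  then obtain L where L: "L-lipschitz_on {0..b} (\<lambda>x. \<Sum>j\<le>Suc I. \<gamma> x j * ln (G j x))"
    using lipschitz_on_sum_real[of "{..Suc I}" "{0..b}" "\<lambda>j x. \<gamma> x j * ln (G j x)"] by auto
  obtain M where M: "M-lipschitz_on {0..b} (\<lambda>x. \<Sum>j\<le>Suc I. real j * \<gamma> x j)"
    using path_sum_lipschitz_on[OF \<gamma> \<theta>, of "Suc I" real] lipschitz_on_subset[OF _ sub] by blast
  show ?thesis
    unfolding potential_def
    using lipschitz_on_add[OF lipschitz_on_add[OF lipschitz_on_id L]
        lipschitz_on_cmult_real[OF lipschitz_on_diff[OF lipschitz_on_id M]]] by blast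
qed

lemma tangent_le_relent:
  "AE x in lborel. x \<in> {0<..<\<beta>} \<longrightarrow> ereal (tangent \<gamma> \<theta> x) \<le> relent I (\<theta> x) (\<gamma> x)"
  using ratesD[OF \<theta>] rate_eq_0_if_ratio_eq_0
proof eventually_elim
  case (elim x)
  show ?case
  proof
    assume x: "x \<in> {0<..<\<beta>}"
    show "ereal (tangent \<gamma> \<theta> x) \<le> relent I (\<theta> x) (\<gamma> x)"
      unfolding tangent_def
    proof (rule relent_ge_tangent)
      show "in_SI I (\<theta> x)" using elim x by blast
      show "in_SI I (\<gamma> x)" using AsetD(2)[OF \<gamma>] x by simp
      show "0 \<le> ratio j x" if "j \<le> Suc I" for j using ratio_nonneg that x by simp
      show "\<theta> x j = 0" if "j \<le> Suc I" "ratio j x = 0" for j using elim x that by blast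
    qed
  qed
qed

lemma potential_increment_le_Jfun:
  assumes b: "0 \<le> b" "b < \<beta>"
  shows "ennreal (potential \<gamma> b - potential \<gamma> 0) \<le> Jfun I \<beta> \<gamma>"
proof -
  obtain L where L: "L-lipschitz_on {0..b} (potential \<gamma>)" using potential_lipschitz_on[OF b(2)] by blast
  have "ennreal (potential \<gamma> b - potential \<gamma> 0) \<le> (\<integral>\<^sup>+ x \<in> {0..b}. e2ennreal (relent I (\<theta> x) (\<gamma> x)) \<partial>lborel)"
  proof (rule lipschitz_increment_le_nn_integral[OF b(1) L])
    show "AE x in lborel. x \<in> {0<..<b} \<longrightarrow> (potential \<gamma> has_real_derivative tangent \<gamma> \<theta> x) (at x)"
      using potential_deriv by eventually_elim (use b in auto)
    show "AE x in lborel. x \<in> {0<..<b} \<longrightarrow> ennreal (tangent \<gamma> \<theta> x) \<le> e2ennreal (relent I (\<theta> x) (\<gamma> x))"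
      using tangent_le_relent
    proof eventually_elim
      case (elim x)
      show ?case
      proof
        assume "x \<in> {0<..<b}"
        then have "ereal (tangent \<gamma> \<theta> x) \<le> relent I (\<theta> x) (\<gamma> x)" using elim b by auto
        from e2ennreal_mono[OF this] show "ennreal (tangent \<gamma> \<theta> x) \<le> e2ennreal (relent I (\<theta> x) (\<gamma> x))"
          by (simp add: e2ennreal_ereal)
      qed
    qed
  qed
  also have "\<dots> \<le> (\<integral>\<^sup>+ x \<in> {0..\<beta>}. e2ennreal (relent I (\<theta> x) (\<gamma> x)) \<partial>lborel)"
    using b by (intro nn_integral_mono) (auto simp: indicator_def)
  also have "\<dots> = Jfun I \<beta> \<gamma>"
    using Jfun_eq_nn_integral_rates[OF AsetD(1)[OF \<gamma>] \<theta>] by simp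
  finally show ?thesis .
qed

lemma path_tendsto_end:
  assumes "j \<le> Suc I"
  shows "((\<lambda>x. \<gamma> x j) \<longlongrightarrow> \<omega> j) (at_left \<beta>)"
proof -
  have "((\<lambda>x. \<gamma> x j) \<longlongrightarrow> \<gamma> \<beta> j) (at \<beta> within {0..\<beta>})"
    using lipschitz_on_continuous_on[OF path_lipschitz_on[OF \<gamma> \<theta> assms]] \<beta>_pos
    unfolding continuous_on_def by simp
  then show ?thesis by (simp add: at_within_Icc_at_left[OF \<beta>_pos] AsetD(4)[OF \<gamma> assms])
qed

text \<open>If \<open>G j\<close> vanishes at \<open>\<beta>\<close>, then \<open>\<omega> j = 0\<close>; the competitor is at most \<open>\<beta> - x\<close> there, which beats
  the logarithmic singularity of \<open>ln (G j x)\<close>.\<close>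

lemma path_mult_ln_G_tendsto:
  assumes j: "j \<le> Suc I"
  shows "((\<lambda>x. \<gamma> x j * ln (G j x)) \<longlongrightarrow> \<omega> j * ln (G j \<beta>)) (at_left \<beta>)"
proof -
  have GL: "(G j \<longlongrightarrow> G j \<beta>) (at_left \<beta>)"
    using DERIV_isCont[OF G_deriv[OF j]] by (auto simp: isCont_def intro: tendsto_mono[OF at_le])
  show ?thesis
  proof (cases "G j \<beta> = 0")
    case False
    then show ?thesis using path_tendsto_end[OF j] GL by (intro tendsto_mult tendsto_ln)
  next
    case z: True
    then have \<omega>0: "\<omega> j = 0" using \<omega>_eq_0_if_G_end_eq_0 j by blast
    have near: "\<forall>\<^sub>F x in at_left \<beta>. x \<in> {0<..<\<beta>}" by (rule eventually_at_left_real[OF \<beta>_pos])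
    have "((\<lambda>x. \<gamma> x j * ln (G j x)) \<longlongrightarrow> 0) (at_left \<beta>)"
      using j
    proof (cases rule: G_pos_or_zero)
      case zero
      have "\<forall>\<^sub>F x in at_left \<beta>. \<gamma> x j * ln (G j x) = 0"
        using near by eventually_elim (use zero j in auto)
      then show ?thesis by (rule tendsto_eventually)
    next
      case (pos c m)
      \<comment> \<open>Near \<beta> the logarithm is thus negative, and the lower bound
        \<open>c * (\<beta> - x) ^ m\<close> on \<open>G j x\<close> caps
        \<open>- ln (G j x)\<close> by a multiple of \<open>- ln (\<beta> - x)\<close> plus a
        constant.\<close>
      have "\<forall>\<^sub>F x in at_left \<beta>. G j x < 1" using GL z by (intro order_tendstoD(2)) auto
      then have "\<forall>\<^sub>F x in at_left \<beta>. norm (\<gamma> x j * ln (G j x))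
          \<le> \<bar>ln c\<bar> * (\<beta> - x) - real m * ((\<beta> - x) * ln (\<beta> - x))"
        using near
      proof eventually_elim
        case (elim x)
        have \<gamma>x: "0 \<le> \<gamma> x j" "\<gamma> x j \<le> \<beta> - x"
        proof -
          show "0 \<le> \<gamma> x j" using AsetD(2)[OF \<gamma>, of x] elim j by (simp add: in_SI_def)
          show "\<gamma> x j \<le> \<beta> - x"
            using lipschitz_onD[OF path_lipschitz_on[OF \<gamma> \<theta> j], of x \<beta>] elim AsetD(4)[OF \<gamma> j] \<omega>0
            by (simp add: dist_real_def)
        qed
        have Gx: "0 < G j x" using pos(3)[of x] elim by simp
        have "ln (c * (\<beta> - x) ^ m) \<le> ln (G j x)"
          using pos(1) pos(2)[of x] elim Gx by (subst ln_le_cancel_iff) auto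
        then have "- ln (G j x) \<le> \<bar>ln c\<bar> - real m * ln (\<beta> - x)"
          using pos(1) elim by (simp add: ln_mult ln_realpow)
        moreover have "ln (G j x) \<le> 0" using Gx elim by simp
        ultimately have "\<gamma> x j * - ln (G j x) \<le> (\<beta> - x) * (\<bar>ln c\<bar> - real m * ln (\<beta> - x))"
          using \<gamma>x elim by (intro mult_mono) auto
        then show ?case using \<gamma>x \<open>ln (G j x) \<le> 0\<close> by (simp add: abs_mult algebra_simps)
      qed
      moreover have "((\<lambda>x. \<bar>ln c\<bar> * (\<beta> - x) - real m * ((\<beta> - x) * ln (\<beta> - x))) \<longlongrightarrow> 0) (at_left \<beta>)"
      proof -
        have "filterlim (\<lambda>x. \<beta> - x) (at_right 0) (at_left \<beta>)"
          unfolding filterlim_at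
          using near by (auto intro!: tendsto_eq_intros elim: eventually_mono)
        from filterlim_compose[OF tendsto_mult_ln_at_right_0 this]
        have "((\<lambda>x. \<bar>ln c\<bar> * (\<beta> - x) - real m * ((\<beta> - x) * ln (\<beta> - x)))
            \<longlongrightarrow> \<bar>ln c\<bar> * (\<beta> - \<beta>) - real m * 0) (at_left \<beta>)"
          by (intro tendsto_diff tendsto_mult tendsto_const tendsto_ident_at)
        then show ?thesis by simp
      qed
      ultimately show ?thesis by (rule Lim_null_comparison)
    qed
    then show ?thesis using \<omega>0 by simp
  qed
qed

lemma potential_tendsto_end: "(potential \<gamma> \<longlongrightarrow> end_value) (at_left \<beta>)"
  unfolding potential_def end_value_def
  by (intro tendsto_add tendsto_sum tendsto_mult tendsto_diff tendsto_const tendsto_ident_at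
      path_mult_ln_G_tendsto path_tendsto_end) simp_all

lemma potential_0: "potential \<gamma> 0 = 0"
proof -
  have "(\<Sum>j\<le>Suc I. \<gamma> 0 j * ln (G j 0)) = 0" "(\<Sum>j\<le>Suc I. real j * \<gamma> 0 j) = 0"
    using AsetD(3)[OF \<gamma>] G_0_0 by (auto intro!: sum.neutral simp: empty_init_def simp del: sum.atMost_Suc)
  then show ?thesis by (simp only: potential_def) simp
qed

lemma end_value_le_Jfun: "ennreal end_value \<le> Jfun I \<beta> \<gamma>"
proof (rule tendsto_upperbound)
  show "((\<lambda>x. ennreal (potential \<gamma> x)) \<longlongrightarrow> ennreal end_value) (at_left \<beta>)"
    by (intro tendsto_ennrealI potential_tendsto_end)
  show "\<forall>\<^sub>F x in at_left \<beta>. ennreal (potential \<gamma> x) \<le> Jfun I \<beta> \<gamma>"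
    using eventually_at_left_real[OF \<beta>_pos]
    by eventually_elim (use potential_increment_le_Jfun potential_0 in fastforce)
qed simp

end

end

section \<open>Cost of the candidate path and optimality\<close>

context extremal
begin

lemma borel_measurable_tangent_opt: "(\<lambda>x. tangent opt optrate x) \<in> borel_measurable borel"
proof -
  have [measurable]: "G j \<in> borel_measurable borel" if "j \<le> Suc (Suc I)" for j
    using continuous_on_G[OF that] by (rule borel_measurable_continuous_onI)
  have [measurable]: "(\<lambda>x. opt x j) \<in> borel_measurable borel" "(\<lambda>x. optrate x j) \<in> borel_measurable borel" for j
    using continuous_on_opt continuous_on_optrate by (auto intro: borel_measurable_continuous_onI)
  have [measurable]: "ratio j \<in> borel_measurable borel" if j: "j \<le> Suc I" for j
  proof -
    have [measurable]: "G j \<in> borel_measurable borel" "G (Suc j) \<in> borel_measurable borel"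
      using j by simp_all
    show ?thesis unfolding ratio_def by measurable
  qed
  show ?thesis
    unfolding tangent_def by (intro borel_measurable_add borel_measurable_const borel_measurable_sum
      borel_measurable_diff borel_measurable_times borel_measurable_ln) simp_all
qed

lemma relent_opt:
  assumes "x \<in> {0<..<\<beta>}"
  shows "relent I (optrate x) (opt x) = ereal (tangent opt optrate x)" "0 \<le> tangent opt optrate x"
proof -
  show eq: "relent I (optrate x) (opt x) = ereal (tangent opt optrate x)"
    unfolding tangent_def using assms in_SI_opt in_SI_optrate optrate_eq_ratio
    by (intro relent_eq_tangent) auto
  have "0 \<le> relent I (optrate x) (opt x)"
    using assms in_SI_opt in_SI_optrate by (intro relent_nonneg) auto
  then show "0 \<le> tangent opt optrate x" by (simp add: eq)
qed

text \<open>For the candidate the tangent bound is an equality, so its cost on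
  \<open>{0..b n}\<close> is the increment of its potential. As \<open>ln (G j x)\<close> may be
  singular at \<beta>, the full cost is reached along \<open>b n\<close> increasing to \<beta>, by
  continuity from below of the measure with density \<open>k\<close>.\<close>

lemma Jfun_opt: "Jfun I \<beta> opt = ennreal end_value"
proof -
  define k where "k x = ennreal (tangent opt optrate x)" for x
  have k[measurable]: "k \<in> borel_measurable lborel"
    unfolding k_def using borel_measurable_tangent_opt by measurable
  define b where "b n = \<beta> - \<beta> / real (Suc n)" for n
  have b: "0 \<le> b n" "b n < \<beta>" for n
    using \<beta>_pos by (auto simp: b_def field_simps)
  have bmono: "b m \<le> b n" if "m \<le> n" for m n
    using \<beta>_pos that by (auto simp: b_def intro!: divide_left_mono)
  have blim: "b \<longlonglongrightarrow> \<beta>"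
  proof -
    have "(\<lambda>n. \<beta> - \<beta> * inverse (real (Suc n))) \<longlonglongrightarrow> \<beta> - \<beta> * 0"
      by (intro tendsto_diff tendsto_mult tendsto_const LIMSEQ_inverse_real_of_nat)
    then show ?thesis by (simp add: b_def[abs_def] divide_inverse)
  qed
  have bleft: "filterlim b (at_left \<beta>) sequentially"
    unfolding filterlim_at using blim b by (auto intro!: always_eventually simp: less_imp_neq)
  have inc: "(\<integral>\<^sup>+ x \<in> {0..b n}. k x \<partial>lborel) = ennreal (potential opt (b n))" for n
  proof -
    obtain L where L: "L-lipschitz_on {0..b n} (potential opt)"
      using potential_lipschitz_on[OF opt_in_Aset rates_opt b(2)] by blast
    have "(\<integral>\<^sup>+ x \<in> {0..b n}. k x \<partial>lborel) = ennreal (potential opt (b n) - potential opt 0)"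
    proof (rule nn_integral_derivative_eq_increment[OF b(1) abs_cont_on_lipschitz[OF L]])
      show "AE x in lborel. x \<in> {0<..<b n} \<longrightarrow> (potential opt has_real_derivative tangent opt optrate x) (at x)"
        using potential_deriv[OF opt_in_Aset rates_opt]
      proof eventually_elim
        case (elim x)
        then show ?case using b(2)[of n] by simp
      qed
      have "0 \<le> tangent opt optrate x" if "x \<in> {0<..<b n}" for x
        using relent_opt(2)[of x] that b(2)[of n] by simp
      then show "AE x in lborel. x \<in> {0<..<b n} \<longrightarrow> k x = ennreal (tangent opt optrate x) \<and> 0 \<le> tangent opt optrate x"
        by (intro AE_I2) (simp add: k_def)
    qed
    then show ?thesis by (simp add: potential_0[OF opt_in_Aset rates_opt])
  qed
  have un: "(\<Union>n. {0..b n}) = {0..<\<beta>}"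
  proof safe
    fix x assume x: "x \<in> {0..<\<beta>}"
    then have "\<forall>\<^sub>F n in sequentially. x < b n" using blim by (intro order_tendstoD(1)) auto
    then obtain n where "x < b n" using eventually_sequentially by auto
    then show "x \<in> (\<Union>n. {0..b n})" using x by (intro UN_I[of n]) auto
  next
    fix x n assume "x \<in> {0..b n}"
    then show "x \<in> {0..<\<beta>}" using b(2)[of n] by simp
  qed
  have "(\<lambda>n. emeasure (density lborel k) {0..b n}) \<longlonglongrightarrow> emeasure (density lborel k) (\<Union>n. {0..b n})"
    by (rule Lim_emeasure_incseq) (auto intro!: incseq_SucI dest: order_trans[OF _ bmono[OF le_SucI[OF order_refl]]])
  then have "(\<lambda>n. ennreal (potential opt (b n))) \<longlonglongrightarrow> (\<integral>\<^sup>+ x \<in> {0..<\<beta>}. k x \<partial>lborel)"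
    by (simp add: emeasure_density inc un)
  moreover have "(\<lambda>n. ennreal (potential opt (b n))) \<longlonglongrightarrow> ennreal end_value"
    by (intro tendsto_ennrealI filterlim_compose[OF potential_tendsto_end[OF opt_in_Aset rates_opt] bleft])
  ultimately have "(\<integral>\<^sup>+ x \<in> {0..<\<beta>}. k x \<partial>lborel) = ennreal end_value" by (rule LIMSEQ_unique)
  moreover have "(\<integral>\<^sup>+ x \<in> {0..\<beta>}. e2ennreal (relent I (optrate x) (opt x)) \<partial>lborel)
      = (\<integral>\<^sup>+ x \<in> {0..<\<beta>}. k x \<partial>lborel)"
  proof (rule nn_integral_cong_AE)
    show "AE x in lborel. e2ennreal (relent I (optrate x) (opt x)) * indicator {0..\<beta>} x = k x * indicator {0..<\<beta>} x"
      using AE_lborel_singleton[of 0] AE_lborel_singleton[of \<beta>]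
      by eventually_elim (auto simp: indicator_def relent_opt k_def e2ennreal_ereal)
  qed
  ultimately show ?thesis
    using Jfun_eq_nn_integral_rates[OF AsetD(1)[OF opt_in_Aset] rates_opt] by simp
qed

theorem Jfun_opt_eq_INF: "Jfun I \<beta> opt = (INF \<gamma>\<in>Aset I empty_init \<omega> \<beta>. Jfun I \<beta> \<gamma>)"
proof (rule antisym)
  show "Jfun I \<beta> opt \<le> (INF \<gamma>\<in>Aset I empty_init \<omega> \<beta>. Jfun I \<beta> \<gamma>)"
  proof (rule INF_greatest)
    fix \<gamma> assume \<gamma>: "\<gamma> \<in> Aset I empty_init \<omega> \<beta>"
    show "Jfun I \<beta> opt \<le> Jfun I \<beta> \<gamma>"
      using end_value_le_Jfun[OF \<gamma> rates_SOME[OF AsetD(1)[OF \<gamma>]]] by (simp add: Jfun_opt)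
  qed
qed (rule INF_lower[OF opt_in_Aset])

subsection \<open>Euler--Lagrange equations\<close>

lemma pathrates_opt:
  assumes "j \<le> Suc I"
  shows "pathrates I opt x j = optrate x j"
proof -
  have *: "- deriv (\<lambda>y. \<Sum>k\<le>i. opt y k) x = optrate x i" if "i \<le> I" for i
    using DERIV_imp_deriv[OF opt_cumulative_deriv[OF that]] by simp
  show ?thesis
  proof (cases "j = Suc I")
    case True
    have "(\<Sum>i\<le>I. - deriv (\<lambda>y. \<Sum>k\<le>i. opt y k) x) = (\<Sum>i\<le>I. optrate x i)"
      using * by (intro sum.cong) auto
    then show ?thesis using True sum_optrate[of x] by (simp add: pathrates_def)
  next
    case False
    then show ?thesis using assms * by (simp add: pathrates_def)
  qed
qed

text \<open>The inflow \<open>optrate y I\<close> is strictly positive on the open interval, so the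
  overflow mass rises strictly from 0. This justifies dividing by \<open>1 - \<psi>\<^sub>I\<close>
  in the full equations.\<close>

lemma opt_overflow_pos:
  assumes "\<sigma> \<noteq> 0" and x: "x \<in> {0<..<\<beta>}"
  shows "0 < opt x (Suc I)"
proof -
  obtain c where c: "c > 0" "\<forall>x\<in>{0..\<beta>}. c \<le> G (Suc I) x" using top_dichotomy assms(1) by blast
  have "opt 0 (Suc I) < opt x (Suc I)"
  proof (rule DERIV_pos_imp_increasing_open[where f = "\<lambda>x. opt x (Suc I)"])
    fix y assume y: "0 < y" "y < x"
    have "0 < G (Suc I) y" using c(1) c(2)[rule_format, of y] x y by simp
    then have "0 < drift I (optrate y) (Suc I)" using y by (simp add: drift_def optrate_def)
    then show "\<exists>D. ((\<lambda>x. opt x (Suc I)) has_real_derivative D) (at y) \<and> 0 < D"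
      using opt_deriv by blast
  qed (use x continuous_on_opt in auto)
  then show ?thesis by (simp add: opt_0 empty_init_def)
qed

lemma optrate_div_opt:
  assumes j: "j \<le> Suc I" and x: "x \<in> {0<..<\<beta>}"
  shows "optrate x j / opt x j = ratio j x"
proof (cases "j = Suc I")
  case True
  have "optrate x j = \<sigma> * opt x j" using True by (simp add: optrate_def)
  moreover have "ratio j x = \<sigma>" using ratio_top[of x] x True by simp
  moreover have "\<sigma> = 0 \<or> opt x j \<noteq> 0" using opt_overflow_pos[OF _ x] True by fastforce
  ultimately show ?thesis by (metis div_0 mult_zero_left nonzero_mult_div_cancel_right)
next
  case False
  then show ?thesis using x j by (simp add: optrate_def opt_def ratio_def)
qed

text \<open>The core of both systems of Euler--Lagrange equations: \<open>- ln (ratio i y)\<close>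
  is \<open>ln (G i y) - ln (G (Suc i) y)\<close>, and each logarithm has the negative ratio as
  derivative. In the vanishing alternative both sides reduce to 0 by default values.\<close>

lemma ln_ratio_deriv:
  assumes i: "i \<le> I" and x: "x \<in> {0<..<\<beta>}"
  shows "((\<lambda>y. - ln (ratio i y)) has_real_derivative - ratio i x + ratio (Suc i) x) (at x)"
proof -
  have "Suc i \<le> Suc I" using i by simp
  then show ?thesis
  proof (cases rule: G_pos_or_zero)
    case zero
    have z: "G (Suc i) y = 0" if "y \<in> {0<..<\<beta>}" for y using zero[of "Suc i" y] i that by simp
    have "((\<lambda>y. - ln (ratio i y)) has_real_derivative 0) (at x)"
      by (rule has_field_derivative_transform_within_open[of "\<lambda>_. 0" _ _ "{0<..<\<beta>}"])
        (use x z in \<open>auto simp: ratio_def\<close>)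
    then show ?thesis using z[OF x] by (simp add: ratio_def)
  next
    case (pos c m)
    have p: "0 < G (Suc i) y" "0 < G i y" if "y \<in> {0<..<\<beta>}" for y
    proof -
      show "0 < G (Suc i) y" using pos(3)[of y] that by simp
      then show "0 < G i y"
        using G_Suc_eq_0_if_eq_0[of i y] G_nonneg[of i y] i that by fastforce
    qed
    have "((\<lambda>y. ln (G i y) - ln (G (Suc i) y)) has_real_derivative - ratio i x - - ratio (Suc i) x) (at x)"
      using i x by (intro DERIV_diff ln_G_deriv) auto
    then have "((\<lambda>y. - ln (ratio i y)) has_real_derivative - ratio i x - - ratio (Suc i) x) (at x)"
      by (rule has_field_derivative_transform_within_open[of _ _ _ "{0<..<\<beta>}"])
        (use x p in \<open>auto simp: ratio_def ln_div less_imp_neq[symmetric]\<close>)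
    then show ?thesis by simp
  qed
qed

text \<open>The overflow ratio is the constant \<sigma>, so its logarithm drops out under
  differentiation and each equation becomes \<open>ln_ratio_deriv\<close>.\<close>

lemma EL_full_opt:
  assumes "\<sigma> \<noteq> 0"
  shows "EL_full I \<beta> opt"
proof -
  have ov: "1 - (\<Sum>k\<le>I. opt y k) = opt y (Suc I)" for y by (simp add: opt_overflow)
  have *: "((\<lambda>y. - ln (pathrates I opt y i / opt y i) + ln (pathrates I opt y (Suc I) / (1 - (\<Sum>k\<le>I. opt y k))))
      has_real_derivative - ratio i x + ratio (Suc i) x) (at x)" if i: "i \<le> I" and x: "x \<in> {0<..<\<beta>}" for i x
  proof (rule has_field_derivative_transform_within_open[of _ _ _ "{0<..<\<beta>}"])
    show "((\<lambda>y. - ln (ratio i y) + ln \<sigma>) has_real_derivative - ratio i x + ratio (Suc i) x) (at x)"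
      using DERIV_add[OF ln_ratio_deriv[OF i x] DERIV_const] by simp
    show "- ln (ratio i y) + ln \<sigma> = - ln (pathrates I opt y i / opt y i) +
        ln (pathrates I opt y (Suc I) / (1 - (\<Sum>k\<le>I. opt y k)))" if y: "y \<in> {0<..<\<beta>}" for y
      using optrate_div_opt[of i y] optrate_div_opt[of "Suc I" y] ratio_top[of y] y i
      by (simp add: ov pathrates_opt)
  qed (use x in auto)
  have **: "- pathrates I opt x i / opt x i = - ratio i x" "pathrates I opt x i / opt x i = ratio i x"
    if "i \<le> Suc I" "x \<in> {0<..<\<beta>}" for i x
    using that optrate_div_opt[of i x] by (simp_all add: pathrates_opt)
  show ?thesis
    unfolding EL_full_def Let_def
    using * ** by (simp add: ov)
qed

lemma EL_reduced_opt:
  assumes "K \<le> Suc I"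
  shows "EL_reduced I K \<beta> opt"
  unfolding EL_reduced_def Let_def
proof (intro ballI allI impI)
  fix x i assume x: "x \<in> {0<..<\<beta>}" and iK: "i < K"
  then have i: "i \<le> I" using assms by simp
  \<comment> \<open>The index is shifted by one: 0 stands for the empty sum
    \<open>\<psi>\<^sub>-\<^sub>1\<close>, so consecutive differences are single
    occupancies.\<close>
  let ?\<psi> = "\<lambda>i x. if i = 0 then 0 else \<Sum>k\<le>i - 1. opt x k"
  have \<psi>: "?\<psi> (Suc j) y - ?\<psi> j y = opt y j" for j y
    by (cases j) auto
  have *: "- pathrates I opt y j / opt y j = - ratio j y" "pathrates I opt y j / opt y j = ratio j y"
    if "j \<le> Suc I" "y \<in> {0<..<\<beta>}" for j y
    using that optrate_div_opt[of j y] by (simp_all add: pathrates_opt)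
  have "((\<lambda>y. - ln (pathrates I opt y i / opt y i)) has_real_derivative - ratio i x + ratio (Suc i) x) (at x)"
    by (rule has_field_derivative_transform_within_open[OF ln_ratio_deriv[OF i x], of "{0<..<\<beta>}"])
      (use x i * in auto)
  then show "((\<lambda>y. - ln (pathrates I opt y i / (?\<psi> (Suc i) y - ?\<psi> i y)))
           has_real_derivative
           (- pathrates I opt x i / (?\<psi> (Suc i) x - ?\<psi> i x)
            + pathrates I opt x (Suc i) / (?\<psi> (Suc (Suc i)) x - ?\<psi> (Suc i) x))) (at x)"
    unfolding \<psi> using * x i by simp
qed

end

section \<open>Twist parameters\<close>

lemma sum_poisP_less_1:
  assumes "t > 0"
  shows "(\<Sum>i<n. poisP i t) < 1"
proof -
  have "(\<Sum>i<n. t ^ i /\<^sub>R fact i) < (\<Sum>i. t ^ i /\<^sub>R fact i)"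
    using assms by (intro sum_less_suminf summable_exp_generic) simp
  also have "\<dots> = exp t" by (simp add: exp_def)
  finally have "exp (- t) * (\<Sum>i<n. t ^ i /\<^sub>R fact i) < exp (- t) * exp t" by simp
  then show ?thesis
    by (simp add: poisP_def sum_distrib_left exp_minus_inverse mult.commute flip: exp_add) 
      (simp add: divide_inverse mult_ac)
qed

lemma sum_mult_poisP: "(\<Sum>i\<le>n. real i * poisP i t) = t * (\<Sum>i<n. poisP i t)"
proof (induction n)
  case (Suc n)
  have "real (Suc n) * poisP (Suc n) t = t * poisP n t"
    by (simp add: poisP_def divide_simps)
  then show ?case using Suc by (simp add: algebra_simps)
qed simp

text \<open>Clearing denominators turns the twist conditions into two linear identities, which later
  become \<open>G 0 0 = 1\<close> and \<open>G (Suc 0) 0 = 1\<close>. The division is legitimate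
  because Poisson partial sums are below 1; the shift in \<open>sum_mult_poisP\<close> reduces the
  numerator to such a sum as well.\<close>

lemma twist_not_tight:
  assumes \<beta>: "\<beta> > 0" and \<omega>: "in_SI I \<omega>" and tw: "twist I \<omega> \<beta> \<rho> C" and nt: "\<not> tight I \<omega> \<beta>"
  shows "\<rho> > 0" "C > 0"
    and "C * (1 - (\<Sum>i\<le>I. poisP i (\<rho> * \<beta>))) + (\<Sum>i\<le>I. \<omega> i) = 1"
    and "C * (\<rho> * \<beta> - (\<Sum>i\<le>I. real i * poisP i (\<rho> * \<beta>))) + (\<Sum>i\<le>I. real i * \<omega> i) = \<beta>"
proof -
  define A B R w where "A = \<rho> * \<beta> - (\<Sum>i\<le>I. real i * poisP i (\<rho> * \<beta>))"
    and "B = 1 - (\<Sum>i\<le>I. poisP i (\<rho> * \<beta>))" and "R = \<beta> - (\<Sum>i\<le>I. real i * \<omega> i)"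
    and "w = 1 - (\<Sum>i\<le>I. \<omega> i)"
  have \<rho>: "\<rho> > 0" and eq: "A / B = R / w" and C: "C = w / B"
    using tw nt by (simp_all add: twist_def A_def B_def R_def w_def)
  have t: "\<rho> * \<beta> > 0" using \<rho> \<beta> by simp
  have B: "B > 0" using sum_poisP_less_1[OF t, of "Suc I"] by (simp add: B_def lessThan_Suc_atMost)
  have "(\<rho> * \<beta>) * (\<Sum>i<I. poisP i (\<rho> * \<beta>)) < (\<rho> * \<beta>) * 1"
    using t sum_poisP_less_1[OF t, of I] by (intro mult_strict_left_mono)
  then have A: "A > 0" unfolding A_def sum_mult_poisP by simp
  have "w = \<omega> (Suc I)" using \<omega> by (simp add: w_def in_SI_def)
  then have "w \<ge> 0" using \<omega> by (simp add: in_SI_def)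
  \<comment> \<open>For \<open>w = 0\<close> the right side of the twist equation would be the
    default value 0 of division by zero, while \<open>A / B\<close> is positive.\<close>
  moreover have "w \<noteq> 0"
  proof
    assume "w = 0"
    then have "A / B = 0" using eq by simp
    then show False using A B by simp
  qed
  ultimately have w: "w > 0" by simp
  show "\<rho> > 0" by (rule \<rho>)
  show "C > 0" using C w B by simp
  have "C * B + (1 - w) = 1" using C B by simp
  then show "C * (1 - (\<Sum>i\<le>I. poisP i (\<rho> * \<beta>))) + (\<Sum>i\<le>I. \<omega> i) = 1" by (simp add: B_def w_def)
  have "C * A = w * (A / B)" using C by simp
  also have "\<dots> = R" using eq w by simp
  finally show "C * (\<rho> * \<beta> - (\<Sum>i\<le>I. real i * poisP i (\<rho> * \<beta>))) + (\<Sum>i\<le>I. real i * \<omega> i) = \<beta>"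
    by (simp add: A_def R_def)
qed

text \<open>\<open>(-1)\<^sup>j\<close> times the \<open>j\<close>-th derivative of \<open>(1 - x / \<beta>)\<^sup>k\<close>.\<close>

definition power_deriv :: "real \<Rightarrow> nat \<Rightarrow> nat \<Rightarrow> real \<Rightarrow> real" where
  "power_deriv \<beta> j k x = (if j \<le> k then fact k / fact (k - j) / \<beta> ^ j * (1 - x / \<beta>) ^ (k - j) else 0)"

lemma power_deriv_has_derivative:
  assumes "\<beta> > 0"
  shows "(power_deriv \<beta> j k has_real_derivative - power_deriv \<beta> (Suc j) k x) (at x)"
proof (cases "j < k")
  case True
  then obtain m where m: "k = Suc (j + m)" using less_iff_Suc_add by auto
  have km: "k - j = Suc m" "k - Suc j = m" using m by auto
  have "((\<lambda>x. fact k / fact (Suc m) / \<beta> ^ j * (1 - x / \<beta>) ^ Suc m) has_real_derivative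
      fact k / fact (Suc m) / \<beta> ^ j * (real (Suc m) * (1 - x / \<beta>) ^ m * (- 1 / \<beta>))) (at x)"
    using assms by (auto intro!: derivative_eq_intros simp: mult_ac simp del: power_Suc of_nat_Suc fact_Suc)
  moreover have "fact k / fact (Suc m) / \<beta> ^ j * (real (Suc m) * (1 - x / \<beta>) ^ m * (- 1 / \<beta>))
      = - (fact k / fact m / \<beta> ^ Suc j * (1 - x / \<beta>) ^ m)"
    by (simp add: fact_Suc)
  moreover have "power_deriv \<beta> j k = (\<lambda>x. fact k / fact (Suc m) / \<beta> ^ j * (1 - x / \<beta>) ^ Suc m)"
    "power_deriv \<beta> (Suc j) k x = fact k / fact m / \<beta> ^ Suc j * (1 - x / \<beta>) ^ m"
    unfolding power_deriv_def km using True by (simp_all add: fun_eq_iff)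
  ultimately show ?thesis by metis
next
  case False
  then have "power_deriv \<beta> j k = (\<lambda>_. if j = k then fact k / \<beta> ^ j else 0)"
    "power_deriv \<beta> (Suc j) k x = 0"
    by (auto simp: power_deriv_def fun_eq_iff)
  then show ?thesis by simp
qed

lemma power_deriv_end:
  assumes "\<beta> > 0"
  shows "power_deriv \<beta> j k \<beta> = (if k = j then fact j / \<beta> ^ j else 0)"
  using assms by (auto simp: power_deriv_def)

section \<open>Closed form of the candidate and verification of the locale assumptions\<close>

context
  fixes I :: nat and \<beta> \<rho> C :: real and \<omega> :: "nat \<Rightarrow> real"
  assumes \<beta>: "\<beta> > 0" and \<omega>: "in_SI I \<omega>" and tw: "twist I \<omega> \<beta> \<rho> C"
begin

text \<open>One index range up to \<open>Suc I\<close> serves both cases, absorbing the distinction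
  made by \<open>effI\<close>: the top coefficient is that of level \<open>I + 1\<close> in the
  tight case and 0 otherwise.\<close>

definition coef :: "nat \<Rightarrow> real" where
  "coef k = (if k \<le> I then \<omega> k - C * poisP k (\<rho> * \<beta>) else if tight I \<omega> \<beta> then \<omega> k else 0)"

definition opt_deriv_abs :: "nat \<Rightarrow> real \<Rightarrow> real" where
  "opt_deriv_abs j x = C * \<rho> ^ j * exp (- \<rho> * x) + (\<Sum>k\<le>Suc I. coef k * power_deriv \<beta> j k x)"

lemma opt_deriv_abs_deriv:
  "(opt_deriv_abs j has_real_derivative - opt_deriv_abs (Suc j) x) (at x)"
proof -
  have "((\<lambda>x. C * \<rho> ^ j * exp (- \<rho> * x)) has_real_derivative - (C * \<rho> ^ Suc j * exp (- \<rho> * x))) (at x)"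
    by (auto intro!: derivative_eq_intros)
  moreover have "((\<lambda>x. \<Sum>k\<le>Suc I. coef k * power_deriv \<beta> j k x) has_real_derivative
      (\<Sum>k\<le>Suc I. coef k * - power_deriv \<beta> (Suc j) k x)) (at x)"
    by (intro DERIV_sum DERIV_cmult power_deriv_has_derivative \<beta>)
  ultimately have "(opt_deriv_abs j has_real_derivative
      - (C * \<rho> ^ Suc j * exp (- \<rho> * x)) + (\<Sum>k\<le>Suc I. coef k * - power_deriv \<beta> (Suc j) k x)) (at x)"
    unfolding opt_deriv_abs_def by (rule DERIV_add)
  moreover have "- (C * \<rho> ^ Suc j * exp (- \<rho> * x)) + (\<Sum>k\<le>Suc I. coef k * - power_deriv \<beta> (Suc j) k x)
      = - opt_deriv_abs (Suc j) x"
    by (simp only: opt_deriv_abs_def mult_minus_right sum_negf minus_add_distrib)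
  ultimately show ?thesis by simp
qed

lemma twist_tight: "tight I \<omega> \<beta> \<Longrightarrow> C = 0 \<and> \<rho> = 1"
  using tw by (simp add: twist_def)

lemma coef_tight:
  assumes "tight I \<omega> \<beta>"
  shows "coef k = \<omega> k"
  unfolding coef_def using twist_tight[OF assms] assms by simp

lemma opt0_eq: "opt0 I \<omega> \<beta> \<rho> C = opt_deriv_abs 0"
proof
  fix x
  have "(\<Sum>k\<le>effI I \<omega> \<beta>. (\<omega> k - C * poisP k (\<rho> * \<beta>)) * (1 - x / \<beta>) ^ k)
      = (\<Sum>k\<le>Suc I. coef k * (1 - x / \<beta>) ^ k)"
  proof (cases "effI I \<omega> \<beta> = Suc I")
    case True
    then have "tight I \<omega> \<beta>" by (auto simp: effI_def split: if_splits)
    then show ?thesis unfolding True using coef_tight twist_tight by simp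
  next
    case False
    then have "effI I \<omega> \<beta> = I" "coef (Suc I) = 0"
      using \<omega> by (auto simp: effI_def coef_def in_SI_def less_le split: if_splits)
    then show ?thesis by (auto simp: coef_def intro!: sum.cong)
  qed
  then show "opt0 I \<omega> \<beta> \<rho> C x = opt_deriv_abs 0 x"
    unfolding opt0_def opt_deriv_abs_def by (simp add: power_deriv_def)
qed

lemma iterated_deriv_opt0:
  "(deriv ^^ j) (opt0 I \<omega> \<beta> \<rho> C) = (\<lambda>x. (- 1) ^ j * opt_deriv_abs j x)"
proof (induction j)
  case 0
  then show ?case by (simp add: opt0_eq)
next
  case (Suc j)
  have "deriv (\<lambda>x. (- 1) ^ j * opt_deriv_abs j x) x = (- 1) ^ Suc j * opt_deriv_abs (Suc j) x" for x
    using DERIV_imp_deriv[OF DERIV_cmult[OF opt_deriv_abs_deriv[of j x], of "(- 1) ^ j"]] by simp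
  then show ?case by (auto simp only: funpow.simps comp_def Suc)
qed

lemma opt_deriv_abs_above_top: "opt_deriv_abs (Suc (Suc I)) x = C * \<rho> ^ Suc (Suc I) * exp (- \<rho> * x)"
  by (simp add: opt_deriv_abs_def power_deriv_def)

lemma opt_deriv_abs_top:
  "opt_deriv_abs (Suc I) x = C * \<rho> ^ Suc I * exp (- \<rho> * x) + coef (Suc I) * (fact (Suc I) / \<beta> ^ Suc I)"
  by (simp add: opt_deriv_abs_def power_deriv_def)

text \<open>At \<beta> only the term \<open>k = j\<close> of the polynomial survives, and the
  exponential contributes exactly the \<open>C * poisP j (\<rho> * \<beta>)\<close> that
  \<open>coef\<close> has subtracted.\<close>

lemma opt_deriv_abs_end:
  assumes "j \<le> I"
  shows "\<beta> ^ j / fact j * opt_deriv_abs j \<beta> = \<omega> j"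
proof -
  have "(\<Sum>k\<le>Suc I. coef k * power_deriv \<beta> j k \<beta>) = coef j * (fact j / \<beta> ^ j)"
    using assms \<beta> by (subst sum.remove[of _ j]) (auto simp: power_deriv_end intro!: sum.neutral)
  then have "\<beta> ^ j / fact j * opt_deriv_abs j \<beta> = C * (exp (- (\<rho> * \<beta>)) * (\<rho> * \<beta>) ^ j / fact j) + coef j"
    using \<beta> by (simp add: opt_deriv_abs_def field_simps power_mult_distrib)
  then show ?thesis using assms by (simp add: coef_def poisP_def)
qed

lemma opt_deriv_abs_0_0: "opt_deriv_abs 0 0 = 1"
proof -
  have "opt_deriv_abs 0 0 = C + (\<Sum>k\<le>Suc I. coef k)" by (simp add: opt_deriv_abs_def power_deriv_def)
  also have "\<dots> = 1"
  proof (cases "tight I \<omega> \<beta>")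
    case True
    then have "(\<Sum>k\<le>Suc I. coef k) = (\<Sum>k\<le>Suc I. \<omega> k)"
      using coef_tight by (intro sum.cong) auto
    then show ?thesis using twist_tight[OF True] \<omega> by (simp add: in_SI_def)
  next
    case False
    have "(\<Sum>k\<le>Suc I. coef k) = (\<Sum>k\<le>I. \<omega> k - C * poisP k (\<rho> * \<beta>))"
      using False by (simp add: coef_def)
    then show ?thesis using twist_not_tight(3)[OF \<beta> \<omega> tw False]
      by (simp add: sum_subtractf sum_distrib_left algebra_simps)
  qed
  finally show ?thesis .
qed

lemma opt_deriv_abs_1_0: "opt_deriv_abs (Suc 0) 0 = 1"
proof -
  have pd: "power_deriv \<beta> (Suc 0) k 0 = real k / \<beta>" for k
    by (cases k) (simp_all add: power_deriv_def)
  have "opt_deriv_abs (Suc 0) 0 = C * \<rho> + (\<Sum>k\<le>Suc I. real k * coef k) / \<beta>"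
    unfolding opt_deriv_abs_def pd sum_divide_distrib by (simp add: mult.commute)
  also have "\<dots> = 1"
  proof (cases "tight I \<omega> \<beta>")
    case True
    then have "(\<Sum>k\<le>Suc I. real k * coef k) = (\<Sum>k\<le>Suc I. real k * \<omega> k)"
      using coef_tight by (intro sum.cong) auto
    also have "\<dots> = \<beta>" using True by (simp add: tight_def)
    finally show ?thesis using twist_tight[OF True] \<beta> by simp
  next
    case False
    have "(\<Sum>k\<le>Suc I. real k * coef k) = (\<Sum>k\<le>I. real k * \<omega> k - C * (real k * poisP k (\<rho> * \<beta>)))"
      using False by (simp add: coef_def algebra_simps)
    also have "\<dots> = \<beta> - C * \<rho> * \<beta>"
      using twist_not_tight(4)[OF \<beta> \<omega> tw False]
      by (simp add: sum_subtractf sum_distrib_left algebra_simps)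
    finally show ?thesis using \<beta> by (simp add: field_simps)
  qed
  finally show ?thesis .
qed

text \<open>In the tight case \<open>C = 0\<close>, so the top function is a constant proportional
  to \<open>\<omega> (Suc I)\<close>, zero or positive. Otherwise the polynomial is used up at order
  \<open>Suc I\<close>, and a positive exponential remains, reproduced by differentiation up to the
  factor \<rho> and bounded below by its value at \<beta>.\<close>

lemma extremal_opt_deriv_abs:
  "extremal I \<beta> (if tight I \<omega> \<beta> then 0 else \<rho>) \<omega> opt_deriv_abs"
proof (cases "tight I \<omega> \<beta>")
  case True
  have C: "C = 0" using twist_tight[OF True] by simp
  have top: "opt_deriv_abs (Suc I) x = \<omega> (Suc I) * (fact (Suc I) / \<beta> ^ Suc I)" for x
    unfolding opt_deriv_abs_top coef_tight[OF True] using C by simp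
  have "fact (Suc I) / \<beta> ^ Suc I > 0" using \<beta> by simp
  moreover have "\<omega> (Suc I) \<ge> 0" using \<omega> by (simp add: in_SI_def)
  ultimately have "opt_deriv_abs (Suc I) \<beta> = 0 \<longleftrightarrow> \<omega> (Suc I) = 0" "opt_deriv_abs (Suc I) \<beta> \<ge> 0"
    unfolding top by (metis less_irrefl mult_eq_0_iff, metis less_imp_le mult_nonneg_nonneg)
  then have "opt_deriv_abs (Suc I) \<beta> = 0 \<Longrightarrow> \<omega> (Suc I) = 0"
    "(\<forall>x\<in>{0..\<beta>}. opt_deriv_abs (Suc I) x = 0) \<or> (\<exists>c>0. \<forall>x\<in>{0..\<beta>}. c \<le> opt_deriv_abs (Suc I) x)"
    by (auto simp only: top order_le_less)
  then show ?thesis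
    using True \<beta> \<omega> opt_deriv_abs_deriv opt_deriv_abs_0_0 opt_deriv_abs_1_0 opt_deriv_abs_end
      opt_deriv_abs_above_top
    by unfold_locales (auto simp: C)
next
  case False
  note \<rho> = twist_not_tight(1,2)[OF \<beta> \<omega> tw False]
  have top: "opt_deriv_abs (Suc I) x = C * \<rho> ^ Suc I * exp (- \<rho> * x)" for x
    unfolding opt_deriv_abs_top using False by (simp add: coef_def)
  have "C * \<rho> ^ Suc I * exp (- \<rho> * \<beta>) \<le> opt_deriv_abs (Suc I) x" if "x \<in> {0..\<beta>}" for x
    unfolding top using \<rho> that by (intro mult_left_mono) auto
  moreover have "C * \<rho> ^ Suc I * exp (- \<rho> * \<beta>) > 0" using \<rho> by simp
  ultimately have "\<exists>c>0. \<forall>x\<in>{0..\<beta>}. c \<le> opt_deriv_abs (Suc I) x" "opt_deriv_abs (Suc I) \<beta> > 0"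
    using top by auto
  then show ?thesis
    using False \<beta> \<omega> opt_deriv_abs_deriv opt_deriv_abs_0_0 opt_deriv_abs_1_0 opt_deriv_abs_end \<rho>
      opt_deriv_abs_above_top top
    by unfold_locales auto
qed

lemma optpath_eq: "optpath I \<omega> \<beta> \<rho> C = extremal.opt I opt_deriv_abs"
proof -
  have *: "x ^ j / fact j * (- 1) ^ j * (deriv ^^ j) (opt0 I \<omega> \<beta> \<rho> C) x = x ^ j / fact j * opt_deriv_abs j x" for j x
  proof -
    have "(- 1 :: real) ^ j * (- 1) ^ j = 1" by (simp flip: power_add)
    then show ?thesis unfolding iterated_deriv_opt0 by (simp add: mult.assoc mult.left_commute)
  qed
  show ?thesis
    unfolding optpath_def extremal.opt_def[OF extremal_opt_deriv_abs] fun_eq_iff * by simp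
qed

end

theorem theorem2p6:
  fixes I :: nat and \<beta> \<rho> C :: real and \<omega> :: "nat \<Rightarrow> real"
  assumes "\<beta> > 0"
    and "in_SI I \<omega>"
    and "Aset I empty_init \<omega> \<beta> \<noteq> {}"
    and "twist I \<omega> \<beta> \<rho> C"
  shows "optpath I \<omega> \<beta> \<rho> C \<in> Aset I empty_init \<omega> \<beta>
    \<and> Jfun I \<beta> (optpath I \<omega> \<beta> \<rho> C) = (INF \<gamma>\<in>Aset I empty_init \<omega> \<beta>. Jfun I \<beta> \<gamma>)
    \<and> (if C = 0 then EL_reduced I (effI I \<omega> \<beta>) \<beta> (optpath I \<omega> \<beta> \<rho> C)
       else EL_full I \<beta> (optpath I \<omega> \<beta> \<rho> C))"
proof -
  note ctx = assms(1,2,4)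
  \<comment> \<open>In the tight case the overflow ratio is 0, although \<open>twist\<close> fixes
    \<rho> to 1 there; hence \<sigma> cannot simply be \<rho>.\<close>
  let ?\<sigma> = "if tight I \<omega> \<beta> then 0 else \<rho>"
  interpret extremal I \<beta> ?\<sigma> \<omega> "opt_deriv_abs I \<beta> \<rho> C \<omega>"
    by (rule extremal_opt_deriv_abs[OF ctx])
  have "EL_full I \<beta> opt" if "C \<noteq> 0"
  proof (rule EL_full_opt)
    have "\<not> tight I \<omega> \<beta>" using twist_tight[OF ctx] that by blast
    then show "?\<sigma> \<noteq> 0" using twist_not_tight(1)[OF ctx] by simp
  qed
  moreover have "EL_reduced I (effI I \<omega> \<beta>) \<beta> opt"
    by (rule EL_reduced_opt) (simp add: effI_def)
  ultimately show ?thesis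
    unfolding optpath_eq[OF ctx] using opt_in_Aset Jfun_opt_eq_INF by presburger
qed

end
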